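(* Let $\mathbb{F}$ be the free Carnot group of step 3 with 2 generators. There is a Lipschitz curve $\gamma\colon[0,1]\to\mathbb{F}$ such that, for every $C^1_H$ curve $\Gamma\colon[0,1]\to\mathbb{F}$, we have $m\{t\in[0,1]:\Gamma(t)=\gamma(t)\}=0$.
   Context: $m$ is Lebesgue measure on $\mathbb{R}$. The free Carnot group of step 3 with 2 generators $\mathbb{F}$ is $\mathbb{R}^5$ with the Lie group law $*$ with identity $0$ for which the following vector fields form a basis of left invariant vector fields: $X_1=\partial_1$, $X_2=\partial_2-x_1\partial_3+\tfrac12x_1^2\partial_4+x_1x_2\partial_5$, $X_3=\partial_3-x_1\partial_4-x_2\partial_5$, $X_4=\partial_4$, $X_5=\partial_5$. Explicitly, $z=x*y$ is given by $z_1=x_1+y_1$, $z_2=x_2+y_2$, $z_3=x_3+y_3-x_1y_2$, $z_4=x_4+y_4-x_1y_3+\tfrac12x_1^2y_2$, $z_5=x_5+y_5-x_2y_3+\tfrac12x_1y_2^2+x_1x_2y_2$. An absolutely continuous curve $\gamma\colon[a,b]\to\mathbb{R}^5$ is horizontal if there are $u_1,u_2\in L^1([a,b])$ with $\gamma'(t)=u_1(t)X_1(\gamma(t))+u_2(t)X_2(\gamma(t))$ for a.e. $t$. Its length is $\ell(\gamma)=\int_a^b\sqrt{u_1^2+u_2^2}$. The Carnot-Carathéodory metric is $d_c(x,y)=\inf\{\ell(\gamma):\gamma\text{ is a horizontal curve joining }x\text{ and }y\}$. A curve $\gamma\colon[0,1]\to\mathbb{F}$ is Lipschitz if there is $L>0$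 with $d_c(\gamma(s),\gamma(t))\le L|s-t|$ for all $s,t$. A curve is $C^1_H$ if it is horizontal and is $C^1$ as a curve in $\mathbb{R}^5$ ($\gamma'$ exists at every point and is continuous). *)

theory Defs
  imports "HOL-Analysis.Analysis"
begin

lemma exhaust_5: "x = 1 \<or> x = 2 \<or> x = 3 \<or> x = 4 \<or> x = 5" for x :: 5
proof (induct x)
  case (of_int z)
  then have "z = 0 \<or> z = 1 \<or> z = 2 \<or> z = 3 \<or> z = 4" by fastforce
  then show ?case by auto
qed

lemma forall_5: "(\<forall>i::5. P i) \<longleftrightarrow> P 1 \<and> P 2 \<and> P 3 \<and> P 4 \<and> P 5"
  by (metis exhaust_5)

lemma vector_5 [simp]:
  "(vector [a,b,c,d,e] :: 'a::zero ^ 5) $ 1 = a"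
  "(vector [a,b,c,d,e] :: 'a::zero ^ 5) $ 2 = b"
  "(vector [a,b,c,d,e] :: 'a::zero ^ 5) $ 3 = c"
  "(vector [a,b,c,d,e] :: 'a::zero ^ 5) $ 4 = d"
  "(vector [a,b,c,d,e] :: 'a::zero ^ 5) $ 5 = e"
  unfolding vector_def by simp_all

section \<open>The group \<open>\<F>\<close>: vector fields and group law on \<open>\<real>\<^sup>5\<close>\<close>

abbreviation coord_field :: "5 \<Rightarrow> real ^ 5"
  where "coord_field i \<equiv> axis i 1"

definition X1 :: "real ^ 5 \<Rightarrow> real ^ 5"
  where "X1 x = coord_field 1"

definition X2 :: "real ^ 5 \<Rightarrow> real ^ 5"
  where "X2 x = coord_field 2 - (x $ 1) *\<^sub>R coord_field 3
      + (1 / 2 * (x $ 1)\<^sup>2) *\<^sub>R coord_field 4 + (x $ 1 * x $ 2) *\<^sub>R coord_field 5"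

definition X3 :: "real ^ 5 \<Rightarrow> real ^ 5"
  where "X3 x = coord_field 3 - (x $ 1) *\<^sub>R coord_field 4 - (x $ 2) *\<^sub>R coord_field 5"

definition X4 :: "real ^ 5 \<Rightarrow> real ^ 5"
  where "X4 x = coord_field 4"

definition X5 :: "real ^ 5 \<Rightarrow> real ^ 5"
  where "X5 x = coord_field 5"

definition F_mult :: "real ^ 5 \<Rightarrow> real ^ 5 \<Rightarrow> real ^ 5"
  where "F_mult x y = vector
    [x $ 1 + y $ 1,
     x $ 2 + y $ 2,
     x $ 3 + y $ 3 - x $ 1 * y $ 2,
     x $ 4 + y $ 4 - x $ 1 * y $ 3 + 1 / 2 * (x $ 1)\<^sup>2 * y $ 2,
     x $ 5 + y $ 5 - x $ 2 * y $ 3 + 1 / 2 * x $ 1 * (y $ 2)\<^sup>2 + x $ 1 * x $ 2 * y $ 2]"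

lemma F_mult_assoc: "F_mult (F_mult x y) z = F_mult x (F_mult y z)"
  by (simp add: vec_eq_iff forall_5 F_mult_def power2_eq_square algebra_simps)

lemma F_mult_0: "F_mult 0 x = x" "F_mult x 0 = x"
  by (simp_all add: vec_eq_iff forall_5 F_mult_def)

lemma F_mult_inverse: "\<exists>y. F_mult x y = 0 \<and> F_mult y x = 0"
  by (rule exI[of _ "vector
    [- x $ 1, - x $ 2, - x $ 3 - x $ 1 * x $ 2,
     - x $ 4 - x $ 1 * x $ 3 - 1 / 2 * (x $ 1)\<^sup>2 * x $ 2,
     - x $ 5 - x $ 2 * x $ 3 - 1 / 2 * x $ 1 * (x $ 2)\<^sup>2]"])
    (simp add: vec_eq_iff forall_5 F_mult_def power2_eq_square field_simps)

lemma F_mult_has_derivative: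
  "(F_mult x has_derivative (\<lambda>v. vector
     [v $ 1,
      v $ 2,
      v $ 3 - x $ 1 * v $ 2,
      v $ 4 - x $ 1 * v $ 3 + 1 / 2 * (x $ 1)\<^sup>2 * v $ 2,
      v $ 5 - x $ 2 * v $ 3 + x $ 1 * y $ 2 * v $ 2 + x $ 1 * x $ 2 * v $ 2])) (at y)"
proof -
  have c: "((\<lambda>y::real^5. y $ j) has_derivative (\<lambda>v. v $ j)) (at y)" for j
    by (rule bounded_linear_imp_has_derivative[OF bounded_linear_vec_nth])
  have *: "\<forall>i::5. ((\<lambda>y. F_mult x y $ i) has_derivative (\<lambda>v. (vector
     [v $ 1,
      v $ 2,
      v $ 3 - x $ 1 * v $ 2,
      v $ 4 - x $ 1 * v $ 3 + 1 / 2 * (x $ 1)\<^sup>2 * v $ 2,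
      v $ 5 - x $ 2 * v $ 3 + x $ 1 * y $ 2 * v $ 2 + x $ 1 * x $ 2 * v $ 2] :: real^5) $ i)) (at y)"
    unfolding forall_5 F_mult_def vector_5
    by (intro conjI; (rule derivative_eq_intros c refl | simp add: algebra_simps)+)
  show ?thesis
    apply (subst has_derivative_componentwise_within)
    using * by (auto simp: Basis_vec_def inner_axis)
qed

lemma left_invariant:
  assumes "X \<in> {X1, X2, X3, X4, X5}"
  shows "\<exists>D. (F_mult x has_derivative D) (at y) \<and> D (X y) = X (F_mult x y)"
  by (rule exI, rule conjI, rule F_mult_has_derivative)
    (use assms in \<open>auto simp: vec_eq_iff forall_5 F_mult_def X1_def X2_def X3_def X4_def X5_def
      axis_def power2_eq_square field_simps\<close>)

section \<open>Horizontal curves and the Carnot-Caratheodory metric\<close>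

definition abs_continuous_curve_on :: "real \<Rightarrow> real \<Rightarrow> (real \<Rightarrow> 'a::metric_space) \<Rightarrow> bool"
  where "abs_continuous_curve_on a b g \<longleftrightarrow>
    (\<forall>\<epsilon>>0. \<exists>\<delta>>0. \<forall>P :: (real \<times> real) set.
      finite P \<longrightarrow> (\<forall>(s, t)\<in>P. a \<le> s \<and> s \<le> t \<and> t \<le> b) \<longrightarrow>
      disjoint_family_on (\<lambda>(s, t). {s<..<t}) P \<longrightarrow>
      (\<Sum>(s, t)\<in>P. t - s) < \<delta> \<longrightarrow> (\<Sum>(s, t)\<in>P. dist (g s) (g t)) < \<epsilon>)"

definition horizontal_with ::
  "real \<Rightarrow> real \<Rightarrow> (real \<Rightarrow> real ^ 5) \<Rightarrow> (real \<Rightarrow> real) \<Rightarrow> (real \<Rightarrow> real) \<Rightarrow> bool"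
  where "horizontal_with a b g u1 u2 \<longleftrightarrow>
    abs_continuous_curve_on a b g \<and>
    u1 absolutely_integrable_on {a..b} \<and> u2 absolutely_integrable_on {a..b} \<and>
    (AE t in lebesgue. t \<in> {a..b} \<longrightarrow>
      (g has_vector_derivative u1 t *\<^sub>R X1 (g t) + u2 t *\<^sub>R X2 (g t)) (at t within {a..b}))"

definition horizontal :: "real \<Rightarrow> real \<Rightarrow> (real \<Rightarrow> real ^ 5) \<Rightarrow> bool"
  where "horizontal a b g \<longleftrightarrow> (\<exists>u1 u2. horizontal_with a b g u1 u2)"

text \<open>The controls of a horizontal curve are determined almost everywhere (they are the derivatives
  of its first two components), so its length may be computed from any choice of them.\<close>

definition control_length :: "real \<Rightarrow> real \<Rightarrow> (real \<Rightarrow> real) \<Rightarrow> (real \<Rightarrow> real) \<Rightarrow> real"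
  where "control_length a b u1 u2 = integral {a..b} (\<lambda>t. sqrt ((u1 t)\<^sup>2 + (u2 t)\<^sup>2))"

text \<open>Values are taken in \<^typ>\<open>ennreal\<close> so that the infimum needs no separate proof that
  any two points are joined by a horizontal curve.\<close>

definition cc_dist :: "real ^ 5 \<Rightarrow> real ^ 5 \<Rightarrow> ennreal"
  where "cc_dist x y = Inf {ennreal (control_length a b u1 u2) | a b g u1 u2.
    a \<le> b \<and> horizontal_with a b g u1 u2 \<and> g a = x \<and> g b = y}"

definition cc_lipschitz :: "(real \<Rightarrow> real ^ 5) \<Rightarrow> bool"
  where "cc_lipschitz g \<longleftrightarrow>
    (\<exists>L>0. \<forall>s\<in>{0..1}. \<forall>t\<in>{0..1}. cc_dist (g s) (g t) \<le> ennreal (L * \<bar>s - t\<bar>))"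

text \<open>At the endpoints the derivative is one-sided.\<close>

definition C1_curve_on :: "real \<Rightarrow> real \<Rightarrow> (real \<Rightarrow> 'a::real_normed_vector) \<Rightarrow> bool"
  where "C1_curve_on a b g \<longleftrightarrow>
    (\<exists>g'. continuous_on {a..b} g' \<and>
      (\<forall>t\<in>{a..b}. (g has_vector_derivative g' t) (at t within {a..b})))"

definition C1H_curve :: "(real \<Rightarrow> real ^ 5) \<Rightarrow> bool"
  where "C1H_curve g \<longleftrightarrow> horizontal 0 1 g \<and> C1_curve_on 0 1 g"

end

theory Submission
  imports Defs
begin

text \<open>
  Let \<open>z\<close> be the projection of a horizontal curve to the plane of the first two coordinates. For
  \<open>d \<in> {1, \<i>, - 1, - \<i>}\<close> and a point \<open>p\<close>, the integral of \<open>(Im (cnj d * (z - p)))\<^sup>2\<close> against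
  \<open>d (Re (cnj d * z))\<close> is the increment of a polynomial in the five coordinates, hence depends only on the
  end points of the curve. It is nonnegative if \<open>z\<close> moves forward in direction \<open>d\<close>, in the sense that
  \<open>Re (cnj d * z)\<close> increases, and it is negative for a path in direction \<open>d\<close> that is interrupted by a
  short detour in the directions \<open>\<i> d, - d, - \<i> d\<close>.

  The curve \<open>\<gamma>\<close> has directions in \<open>{1, \<i>, - 1, - \<i>}\<close> and carries such a detour in the middle of every cell
  of a sequence of nested grids; the detours of finer grids have so small a total length that they do
  not spoil the negative sign. If a \<open>C\<^sup>1\<close> horizontal curve \<open>\<Gamma>\<close> met \<open>\<gamma>\<close> in a set \<open>K\<close> of positive measure, then
  \<open>K\<close> would fill more than three quarters of some cell of an arbitrarily fine grid, and would thus contain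
  points \<open>s\<close>, \<open>t\<close> of the cell that are far apart on either side of the detour. Between them \<open>\<Gamma>\<close> must move
  backward somewhere, because of the negative sign, and forward with speed at least \<open>1 / 2\<close> somewhere else,
  because its end points agree with those of \<open>\<gamma>\<close>. This contradicts the uniform continuity of \<open>\<Gamma>'\<close>.
\<close>

section \<open>Lebesgue density and differentiation\<close>

lemma AE_lebesgue_iff_negligible: "(AE x in lebesgue. P x) \<longleftrightarrow> negligible {x. \<not> P x}"
proof
  assume "AE x in lebesgue. P x"
  then obtain N where "N \<in> null_sets lebesgue" "{x. \<not> P x} \<subseteq> N"
    unfolding eventually_ae_filter by auto
  then show "negligible {x. \<not> P x}"
    unfolding negligible_iff_null_sets by (blast intro: null_sets_completion_subset)
next
  assume "negligible {x. \<not> P x}"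
  then show "AE x in lebesgue. P x"
    unfolding negligible_iff_null_sets eventually_ae_filter by (intro bexI[of _ "{x. \<not> P x}"]) auto
qed

lemma lmeasurable_atLeastLessThan: "{c..<d::real} \<in> lmeasurable"
  by (rule bounded_set_imp_lmeasurable) auto

lemma integrable_on_bounded_measurable:
  fixes V :: "real \<Rightarrow> 'a::euclidean_space"
  assumes "V \<in> borel_measurable (lebesgue_on {c..d})" "\<And>x. x \<in> {c..d} \<Longrightarrow> norm (V x) \<le> B"
  shows "V absolutely_integrable_on {c..d}"
  by (rule measurable_bounded_by_integrable_imp_absolutely_integrable[where g = "\<lambda>_. B"])
    (use assms in auto)

lemma integral_indicator_le:
  assumes "E \<in> lmeasurable"
  shows "(\<lambda>x. indicator E x :: real) integrable_on {p..q::real}" (is ?A)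
    and "integral {p..q} (indicator E) \<le> measure lebesgue E" (is ?B)
proof -
  have "integral {p..q} (indicator E) = measure lebesgue (E \<inter> {p..q})"
    using assms by (subst integral_indicator) (auto simp: Int_commute intro: fmeasurable.Int)
  then show ?B using assms by (auto intro!: measure_mono_fmeasurable)
  show ?A using assms by (simp add: fmeasurable.Int Int_commute integrable_on_indicator)
qed

lemma Im_integral: "w integrable_on S \<Longrightarrow> Im (integral S w) = integral S (\<lambda>x. Im (w x))"
  using integral_linear[OF _ bounded_linear_Im, of w S] by (simp add: o_def)

lemma Re_integral: "w integrable_on S \<Longrightarrow> Re (integral S w) = integral S (\<lambda>x. Re (w x))"
  using integral_linear[OF _ bounded_linear_Re, of w S] by (simp add: o_def)

lemma mvt_field:
  fixes f :: "real \<Rightarrow> real"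
  assumes "a < b" "continuous_on {a..b} f"
    and "\<And>x. a < x \<Longrightarrow> x < b \<Longrightarrow> (f has_real_derivative f' x) (at x)"
  shows "\<exists>\<xi>>a. \<xi> < b \<and> f b - f a = f' \<xi> * (b - a)"
proof -
  have "(f has_derivative (*) (f' x)) (at x)" if "a < x" "x < b" for x
    using assms(3)[OF that] by (simp add: has_field_derivative_def)
  from mvt[OF assms(1,2) this] show ?thesis by blast
qed

text \<open>Choose an open V around A with \<open>measure lebesgue (V - A)\<close> at most
  \<open>e * \<eta>\<close>. The balls in V that violate the estimate form a fine cover of the bad
  points, and the Vitali theorem extracts disjoint ones covering almost all of them. Their parts
  outside A are disjoint subsets of \<open>V - A\<close>, and each exceeds the fraction e of its
  ball, so the balls together have measure at most \<open>\<eta>\<close>.\<close>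

lemma negligible_not_density_point:
  fixes A :: "'a::euclidean_space set"
  assumes A: "A \<in> sets lebesgue" and e: "e > 0"
  shows "negligible {x \<in> A. \<not> (\<forall>\<^sub>F r in at_right 0.
           measure lebesgue (ball x r - A) \<le> e * measure lebesgue (ball x r))}" (is "negligible ?S")
  unfolding negligible_outer_le
proof (intro allI impI)
  fix \<eta> :: real assume \<eta>: "\<eta> > 0"
  let ?\<mu> = "measure lebesgue"
  obtain V where V: "open V" "A \<subseteq> V" "V - A \<in> lmeasurable" "emeasure lebesgue (V - A) < ennreal (e * \<eta>)"
    using sets_lebesgue_outer_open[OF A, of "e * \<eta>"] e \<eta> by auto
  have mV: "?\<mu> (V - A) \<le> e * \<eta>"
    using V(4) e \<eta> unfolding emeasure_eq_measure2[OF V(3)] by (simp add: ennreal_less_iff)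
  let ?K = "{(x, r). 0 < r \<and> ball x r \<subseteq> V \<and> ?\<mu> (ball x r - A) > e * ?\<mu> (ball x r)}"
  have cover: "\<exists>i. i \<in> ?K \<and> x \<in> ball (fst i) (snd i) \<and> snd i < d" if xd: "x \<in> ?S" "0 < d" for x d
  proof -
    obtain \<delta> where \<delta>: "\<delta> > 0" "ball x \<delta> \<subseteq> V"
      using openE[OF V(1), of x] V(2) xd(1) by blast
    have "\<not> (\<forall>r>0. r < min \<delta> d \<longrightarrow> ?\<mu> (ball x r - A) \<le> e * ?\<mu> (ball x r))"
    proof
      assume *: "\<forall>r>0. r < min \<delta> d \<longrightarrow> ?\<mu> (ball x r - A) \<le> e * ?\<mu> (ball x r)"
      have "\<forall>\<^sub>F r in at_right 0. ?\<mu> (ball x r - A) \<le> e * ?\<mu> (ball x r)"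
        unfolding eventually_at_right_field
        by (rule exI[of _ "min \<delta> d"]) (use * xd(2) \<delta>(1) in simp)
      with xd(1) show False by blast
    qed
    then obtain r where "0 < r" "r < min \<delta> d" "?\<mu> (ball x r - A) > e * ?\<mu> (ball x r)"
      unfolding not_all not_imp not_le by blast
    moreover from this have "ball x r \<subseteq> V" using \<delta>(2) by force
    ultimately show ?thesis by (intro exI[of _ "(x, r)"]) auto
  qed
  obtain C where C: "countable C" "C \<subseteq> ?K"
      "pairwise (\<lambda>i j. disjnt (ball (fst i) (snd i)) (ball (fst j) (snd j))) C"
      "negligible (?S - (\<Union>i\<in>C. ball (fst i) (snd i)))"
    using Vitali_covering_theorem_balls[of ?S ?K fst snd] cover by blast
  let ?B = "\<lambda>i::'a \<times> real. ball (fst i) (snd i)"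
  have CV: "?B i \<subseteq> V" "e * ?\<mu> (?B i) \<le> ?\<mu> (?B i - A)" if "i \<in> C" for i
    using subsetD[OF C(2) that] by (auto split: prod.splits)
  have bound: "?\<mu> (\<Union>i\<in>F. ?B i) \<le> \<eta>" if F: "F \<subseteq> C" "finite F" for F
  proof -
    have "e * ?\<mu> (\<Union>i\<in>F. ?B i) \<le> e * (\<Sum>i\<in>F. ?\<mu> (?B i))"
      using e F(2) by (intro mult_left_mono measure_UNION_le) auto
    also have "\<dots> = (\<Sum>i\<in>F. e * ?\<mu> (?B i))" by (simp add: sum_distrib_left)
    also have "\<dots> \<le> (\<Sum>i\<in>F. ?\<mu> (?B i - A))"
      using F(1) CV(2) by (intro sum_mono) blast
    also have "\<dots> = ?\<mu> (\<Union>i\<in>F. ?B i - A)"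
    proof (rule measure_UNION_AE[symmetric, OF F(2)])
      show "pairwise (\<lambda>i j. AE x in lebesgue. x \<notin> ?B i - A \<or> x \<notin> ?B j - A) F"
        using pairwise_subset[OF C(3) F(1)] by (auto simp: pairwise_def disjnt_iff intro!: AE_I2)
    qed (use A in \<open>auto intro!: fmeasurable_Diff\<close>)
    also have "\<dots> \<le> ?\<mu> (V - A)"
    proof (rule measure_mono_fmeasurable[OF _ _ V(3)])
      show "(\<Union>i\<in>F. ?B i - A) \<subseteq> V - A" using F(1) CV by blast
      show "(\<Union>i\<in>F. ?B i - A) \<in> sets lebesgue" using F A by (intro sets.finite_UN) auto
    qed
    also have "\<dots> \<le> e * \<eta>" by (rule mV)
    finally show ?thesis using e by simp
  qed
  let ?U = "\<Union>i\<in>C. ?B i"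
  have U: "?U \<in> lmeasurable" "?\<mu> ?U \<le> \<eta>"
    by (rule fmeasurable_UN_bound[OF C(1) _ bound] measure_UN_bound[OF C(1) _ bound]; simp)+
  show "\<exists>T. ?S \<subseteq> T \<and> T \<in> lmeasurable \<and> ?\<mu> T \<le> \<eta>"
  proof (intro exI conjI)
    show "?S \<subseteq> ?U \<union> (?S - ?U)" by blast
    show "?U \<union> (?S - ?U) \<in> lmeasurable"
      using U(1) C(4) by (intro fmeasurable.Un) (auto simp: negligible_imp_measurable)
    show "?\<mu> (?U \<union> (?S - ?U)) \<le> \<eta>"
      using U C(4) measure_Un_null_set[of ?U lebesgue "?S - ?U"]
      by (simp add: negligible_iff_null_sets fmeasurableD)
  qed
qed

text \<open>The exceptional set of the previous lemma depends on e, but the countably many values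
  \<open>inverse (Suc n)\<close> suffice.\<close>

theorem lebesgue_density:
  fixes A :: "'a::euclidean_space set"
  assumes A: "A \<in> sets lebesgue"
  shows "AE x in lebesgue. x \<in> A \<longrightarrow> (\<forall>e>0. \<forall>\<^sub>F r in at_right 0.
           measure lebesgue (ball x r - A) \<le> e * measure lebesgue (ball x r))"
proof -
  have "AE x in lebesgue. \<forall>n::nat. x \<in> A \<longrightarrow> (\<forall>\<^sub>F r in at_right 0.
          measure lebesgue (ball x r - A) \<le> inverse (Suc n) * measure lebesgue (ball x r))"
    unfolding AE_all_countable
    using negligible_not_density_point[OF A] by (simp add: AE_lebesgue_iff_negligible)
  then show ?thesis
  proof eventually_elim
    case (elim x)
    show ?case
    proof (intro impI allI)
      fix e :: real assume xA: "x \<in> A" and "e > 0"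
      then obtain n where n: "inverse (Suc n) < e" using reals_Archimedean by blast
      from elim xA have "\<forall>\<^sub>F r in at_right 0.
          measure lebesgue (ball x r - A) \<le> inverse (Suc n) * measure lebesgue (ball x r)" by blast
      then show "\<forall>\<^sub>F r in at_right 0. measure lebesgue (ball x r - A) \<le> e * measure lebesgue (ball x r)"
      proof eventually_elim
        case (elim r)
        have "inverse (Suc n) * measure lebesgue (ball x r) \<le> e * measure lebesgue (ball x r)"
          using n by (intro mult_right_mono) auto
        then show ?case using elim by linarith
      qed
    qed
  qed
qed

text \<open>Almost every t is a density point of the preimage under V of each member of a countable
  basis that contains \<open>V t\<close>. Near such a t the values of V are close to
  \<open>V t\<close> except on a set of small relative measure, where boundedness is enough.\<close>

theorem AE_vector_derivative_integral:
  fixes V :: "real \<Rightarrow> 'a::euclidean_space"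
  assumes meas: "V \<in> borel_measurable lebesgue" and bnd: "\<And>x. norm (V x) \<le> B"
  shows "AE t in lebesgue. t \<in> {a..b} \<longrightarrow>
    ((\<lambda>x. integral {a..x} V) has_vector_derivative V t) (at t within {a..b})"
proof -
  obtain \<U> :: "'a set set" where \<U>: "countable \<U>" "topological_basis \<U>"
    using ex_countable_basis by blast
  have int: "V integrable_on {c..d}" for c d
    using integrable_on_bounded_measurable[of V c d B] meas bnd
    by (auto simp: measurable_restrict_space1 absolutely_integrable_on_def)
  have "B \<ge> 0" using bnd[of 0] norm_ge_zero[of "V 0"] by linarith
  have pre: "V -` U \<in> sets lebesgue" if "U \<in> \<U>" for U
    using measurable_sets[OF meas borel_open[OF topological_basis_open[OF \<U>(2) that]]] by simp
  have "AE t in lebesgue. \<forall>U\<in>\<U>. t \<in> V -` U \<longrightarrow> (\<forall>e>0. \<forall>\<^sub>F r in at_right 0.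
           measure lebesgue (ball t r - V -` U) \<le> e * measure lebesgue (ball t r))"
    unfolding AE_ball_countable[OF \<U>(1)] using lebesgue_density[OF pre] by blast
  then show ?thesis
  proof eventually_elim
    case (elim t)
    show ?case
      unfolding has_vector_derivative_def has_derivative_within_alt2
    proof (intro impI conjI allI)
      show "bounded_linear (\<lambda>x. x *\<^sub>R V t)" by (rule bounded_linear_scaleR_left)
      fix e :: real assume t: "t \<in> {a..b}" and e: "e > 0"
      obtain U where U: "U \<in> \<U>" "V t \<in> U" "U \<subseteq> ball (V t) (e / 2)"
        using topological_basisE[OF \<U>(2), of "ball (V t) (e / 2)" "V t"] e by auto
      \<comment> \<open>The exceptional set contributes at most
        \<open>2 * B * (?\<eta> * (2 * r))\<close> with \<open>r = 2 * (q - p)\<close>, hence at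
        most half of \<open>e * (q - p)\<close>. The summand 1 allows \<open>B = 0\<close>.\<close>
      let ?\<eta> = "e / (16 * (B + 1))"
      have \<eta>: "?\<eta> > 0" using e \<open>B \<ge> 0\<close> by simp
      have "\<forall>\<^sub>F r in at_right 0. measure lebesgue (ball t r - V -` U) \<le> ?\<eta> * measure lebesgue (ball t r)"
        using elim U \<eta> by blast
      then obtain d where d: "d > 0"
        "\<And>r. 0 < r \<Longrightarrow> r < d \<Longrightarrow> measure lebesgue (ball t r - V -` U) \<le> ?\<eta> * measure lebesgue (ball t r)"
        unfolding eventually_at_right_field by auto
      have main: "norm (integral {p..q} V - (q - p) *\<^sub>R V t) \<le> e * (q - p)"
        if pq: "p \<le> q" "p = t \<or> q = t" "q - p < d / 2" for p q
      proof (cases "p = q")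
        case False
        \<comment> \<open>Since t is an end point of \<open>{p..q}\<close>, twice the length puts
          the other end point inside the open ball as well.\<close>
        define r where "r = 2 * (q - p)"
        have r: "0 < r" "r < d" "{p..q} \<subseteq> ball t r"
          using pq False by (auto simp: r_def dist_real_def)
        let ?E = "ball t r - V -` U"
        have Em: "?E \<in> lmeasurable"
          using pre[OF U(1)] by (intro fmeasurable_Diff) auto
        have mE: "measure lebesgue ?E \<le> ?\<eta> * (2 * r)"
          using d(2)[OF r(1,2)] r(1) by (simp add: ball_eq_greaterThanLessThan)
        note Ei = integral_indicator_le[OF Em, of p q]
        have "integral {p..q} V - (q - p) *\<^sub>R V t = integral {p..q} (\<lambda>s. V s - V t)"
          using pq int by (subst integral_diff) auto
        also have "norm \<dots> \<le> integral {p..q} (\<lambda>s. e / 2 + 2 * B * indicator ?E s)"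
        proof (rule integral_norm_bound_integral)
          fix s assume s: "s \<in> {p..q}"
          show "norm (V s - V t) \<le> e / 2 + 2 * B * indicator ?E s"
          proof (cases "s \<in> ?E")
            case True
            then show ?thesis using norm_triangle_ineq4[of "V s" "V t"] bnd[of s] bnd[of t] e by simp
          next
            case False
            then have "V s \<in> ball (V t) (e / 2)" using s r(3) U(3) by blast
            then show ?thesis using False by (simp add: dist_norm norm_minus_commute)
          qed
        qed (use int Ei(1) in \<open>auto intro!: integrable_diff integrable_add integrable_on_mult_right\<close>)
        also have "\<dots> = e / 2 * (q - p) + 2 * B * integral {p..q} (indicator ?E)"
          using Ei(1) pq by (subst integral_add) (auto intro: integrable_on_mult_right)
        also have "\<dots> \<le> e / 2 * (q - p) + 2 * B * (?\<eta> * (2 * r))"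
          using order_trans[OF Ei(2) mE] \<open>B \<ge> 0\<close> by (intro add_mono mult_left_mono order_refl) simp_all
        also have "\<dots> = e / 2 * (q - p) + e / 2 * (q - p) * (B / (B + 1))"
        proof -
          have "2 * B * (e / (16 * C) * (2 * (2 * x))) = e / 2 * x * (B / C)" if "C > 0" for C x :: real
            using that by (simp add: field_simps)
          from this[of "B + 1" "q - p"] show ?thesis
            using \<open>B \<ge> 0\<close> unfolding r_def by linarith
        qed
        also have "\<dots> \<le> e / 2 * (q - p) + e / 2 * (q - p) * 1"
          using \<open>B \<ge> 0\<close> e pq by (intro add_mono mult_left_mono) auto
        finally show ?thesis by simp
      qed simp
      show "\<forall>\<^sub>F y in at t within {a..b}. norm (integral {a..y} V - integral {a..t} V - (y - t) *\<^sub>R V t)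
          \<le> e * norm (y - t)"
        unfolding eventually_at
      proof (intro exI conjI ballI impI)
        show "d / 2 > 0" using d by simp
        fix y assume y: "y \<in> {a..b}" "y \<noteq> t \<and> dist y t < d / 2"
        show "norm (integral {a..y} V - integral {a..t} V - (y - t) *\<^sub>R V t) \<le> e * norm (y - t)"
        proof (cases "t \<le> y")
          case True
          then have "integral {a..y} V = integral {a..t} V + integral {t..y} V"
            using Henstock_Kurzweil_Integration.integral_combine[OF _ True int, of a] t by simp
          then show ?thesis using main[of t y] True y by (simp add: dist_real_def)
        next
          case False
          then have "integral {a..t} V = integral {a..y} V + integral {y..t} V"
            using Henstock_Kurzweil_Integration.integral_combine[OF _ _ int, of a y t] y by simp
          then have "norm (integral {a..y} V - integral {a..t} V - (y - t) *\<^sub>R V t)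
              = norm (integral {y..t} V - (t - y) *\<^sub>R V t)"
            by (simp add: norm_minus_commute algebra_simps)
          then show ?thesis using main[of y t] False y by (simp add: dist_real_def)
        qed
      qed
    qed
  qed
qed

text \<open>Outside an open set \<open>V\<close> of small measure covering the exceptional set the increments of \<open>F\<close>
  are controlled by the derivative, inside \<open>V\<close> by the Lipschitz constant.\<close>
lemma lipschitz_AE_derivative_zero:
  fixes F :: "real \<Rightarrow> 'a::real_normed_vector"
  assumes "a \<le> b" and lip: "\<And>x y. x \<in> {a..b} \<Longrightarrow> y \<in> {a..b} \<Longrightarrow> norm (F x - F y) \<le> L * \<bar>x - y\<bar>"
    and der: "AE t in lebesgue. t \<in> {a..b} \<longrightarrow> (F has_vector_derivative 0) (at t within {a..b})"
  shows "F b = F a"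
proof -
  have L: "norm (F x - F y) \<le> \<bar>L\<bar> * \<bar>x - y\<bar>" if "x \<in> {a..b}" "y \<in> {a..b}" for x y
    using lip[OF that] mult_right_mono[OF abs_ge_self[of L], of "\<bar>x - y\<bar>"] by simp
  define N where "N = {t \<in> {a..b}. \<not> (F has_vector_derivative 0) (at t within {a..b})}"
  have "{t. \<not> (t \<in> {a..b} \<longrightarrow> (F has_vector_derivative 0) (at t within {a..b}))} = N"
    by (auto simp: N_def)
  then have N: "negligible N" using der unfolding AE_lebesgue_iff_negligible by simp
  have bound: "norm (F b - F a) \<le> e * (b - a + \<bar>L\<bar>)" if e: "e > 0" for e
  proof -
    obtain V where V: "open V" "N \<subseteq> V" "V - N \<in> lmeasurable" "emeasure lebesgue (V - N) < ennreal e"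
      using sets_lebesgue_outer_open[of N e] N e negligible_imp_sets by blast
    have Vm: "V \<in> lmeasurable"
    proof -
      have "(V - N) \<union> N \<in> lmeasurable"
        using V(3) N by (intro fmeasurable.Un) (auto simp: negligible_imp_measurable)
      moreover have "(V - N) \<union> N = V" using V(2) by blast
      ultimately show ?thesis by simp
    qed
    have "measure lebesgue V = measure lebesgue (V - N)"
      using measure_Diff_null_set[of V lebesgue N] N Vm by (simp add: negligible_iff_null_sets fmeasurableD)
    also have "\<dots> \<le> e"
      using V(4) e unfolding emeasure_eq_measure2[OF V(3)] by (simp add: ennreal_less_iff)
    finally have mV: "measure lebesgue V \<le> e" .
    \<comment> \<open>Such an estimate passes to adjacent intervals, the half-open intervals making
      the measure term additive. By the Bolzano principle it is enough to prove it on short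
      intervals around each point.\<close>
    define P where "P = (\<lambda>u v. a \<le> u \<longrightarrow> v \<le> b \<longrightarrow>
      norm (F v - F u) \<le> e * (v - u) + \<bar>L\<bar> * measure lebesgue (V \<inter> {u..<v}))"
    have "P a b"
      using \<open>a \<le> b\<close>
    proof (induction rule: Bolzano)
      case (trans u v w)
      show ?case
        unfolding P_def
      proof (intro impI)
        assume "a \<le> u" "w \<le> b"
        have "measure lebesgue (V \<inter> {u..<w}) = measure lebesgue ((V \<inter> {u..<v}) \<union> (V \<inter> {v..<w}))"
          using trans(3,4) by (intro arg_cong[where f = "measure lebesgue"]) auto
        also have "\<dots> = measure lebesgue (V \<inter> {u..<v}) + measure lebesgue (V \<inter> {v..<w})"
        proof (rule measure_Union)
          show "emeasure lebesgue (V \<inter> {u..<v}) \<noteq> \<infinity>" "emeasure lebesgue (V \<inter> {v..<w}) \<noteq> \<infinity>"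
            by (rule fmeasurableD2 fmeasurable_Int_fmeasurable Vm | simp)+
        qed (use Vm in \<open>auto dest: fmeasurableD\<close>)
        finally have eq: "\<bar>L\<bar> * measure lebesgue (V \<inter> {u..<w})
          = \<bar>L\<bar> * measure lebesgue (V \<inter> {u..<v}) + \<bar>L\<bar> * measure lebesgue (V \<inter> {v..<w})"
          by (simp add: distrib_left)
        have "norm (F w - F u) \<le> norm (F w - F v) + norm (F v - F u)"
          by (rule norm_diff_triangle_le[OF order_refl order_refl])
        moreover have "norm (F w - F v) \<le> e * (w - v) + \<bar>L\<bar> * measure lebesgue (V \<inter> {v..<w})"
          "norm (F v - F u) \<le> e * (v - u) + \<bar>L\<bar> * measure lebesgue (V \<inter> {u..<v})"
          using trans \<open>a \<le> u\<close> \<open>w \<le> b\<close> unfolding P_def by auto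
        ultimately show "norm (F w - F u) \<le> e * (w - u) + \<bar>L\<bar> * measure lebesgue (V \<inter> {u..<w})"
          unfolding eq by (simp add: algebra_simps)
      qed
    next
      case (local x)
      show ?case
      proof (cases "x \<in> N")
        case True
        then obtain d where d: "d > 0" "ball x d \<subseteq> V"
          using openE[OF V(1), of x] V(2) by blast
        show ?thesis
        proof (intro exI[of _ d] conjI allI impI d(1))
          fix u v assume uv: "u \<le> x \<and> x \<le> v \<and> v - u < d"
          show "P u v"
            unfolding P_def
          proof (intro impI)
            assume "a \<le> u" "v \<le> b"
            have "V \<inter> {u..<v} = {u..<v}" using uv by (auto intro!: subsetD[OF d(2)] simp: dist_real_def)
            then have "measure lebesgue (V \<inter> {u..<v}) = v - u" using uv by simp
            moreover have "norm (F v - F u) \<le> \<bar>L\<bar> * \<bar>v - u\<bar>" 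
              using L[of v u] uv \<open>a \<le> u\<close> \<open>v \<le> b\<close> by simp
            moreover have "0 \<le> e * (v - u)" using e uv by simp
            ultimately show "norm (F v - F u) \<le> e * (v - u) + \<bar>L\<bar> * measure lebesgue (V \<inter> {u..<v})"
              using uv by simp
          qed
        qed
      next
        case False
        then have "(F has_vector_derivative 0) (at x within {a..b})"
          using local by (simp add: N_def)
        then obtain d where d: "d > 0" "\<And>y. y \<in> {a..b} \<Longrightarrow> norm (y - x) < d \<Longrightarrow> norm (F y - F x) \<le> e * norm (y - x)"
          using e unfolding has_vector_derivative_def has_derivative_within_alt by auto
        show ?thesis
        proof (intro exI[of _ d] conjI allI impI d(1))
          fix u v assume uv: "u \<le> x \<and> x \<le> v \<and> v - u < d"
          show "P u v"
            unfolding P_def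
          proof (intro impI)
            assume "a \<le> u" "v \<le> b"
            have "norm (F v - F u) \<le> norm (F v - F x) + norm (F u - F x)"
              by (metis norm_diff_triangle_le norm_minus_commute order_refl)
            also have "\<dots> \<le> e * (v - x) + e * (x - u)"
              using d(2)[of v] d(2)[of u] uv \<open>a \<le> u\<close> \<open>v \<le> b\<close> local by (intro add_mono) auto
            also have "\<dots> = e * (v - u)" by (simp add: algebra_simps)
            finally show "norm (F v - F u) \<le> e * (v - u) + \<bar>L\<bar> * measure lebesgue (V \<inter> {u..<v})"
              using mult_nonneg_nonneg[OF abs_ge_zero[of L] measure_nonneg[of lebesgue "V \<inter> {u..<v}"]]
              by linarith
          qed
        qed
      qed
    qed
    have sV: "V \<inter> {a..<b} \<in> sets lebesgue" using fmeasurableD[OF Vm] by (rule sets.Int) auto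
    from \<open>P a b\<close> have "norm (F b - F a) \<le> e * (b - a) + \<bar>L\<bar> * measure lebesgue (V \<inter> {a..<b})"
      by (simp add: P_def)
    also have "\<dots> \<le> e * (b - a) + \<bar>L\<bar> * e"
      using order_trans[OF measure_mono_fmeasurable[OF Int_lower1 _ Vm, of "{a..<b}"] mV] sV
      by (intro add_left_mono mult_left_mono) auto
    finally show ?thesis by (simp add: algebra_simps)
  qed
  have "norm (F b - F a) \<le> 0"
  proof (rule field_le_epsilon)
    fix e :: real assume "e > 0"
    define K where "K = b - a + \<bar>L\<bar>"
    have "K \<ge> 0" using \<open>a \<le> b\<close> by (simp add: K_def)
    then have "norm (F b - F a) \<le> e / (K + 1) * K"
      using bound[of "e / (K + 1)"] \<open>e > 0\<close> by (simp add: K_def)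
    also have "\<dots> \<le> e" using \<open>e > 0\<close> \<open>K \<ge> 0\<close> by (simp add: field_simps)
    finally show "norm (F b - F a) \<le> 0 + e" by simp
  qed
  then show ?thesis by simp
qed

section \<open>Cells and detours\<close>

text \<open>Summation over the disjoint cells. It serves to refute that all cells of a fine grid are
  thinly filled.\<close>

lemma measure_le_of_thin_cells:
  fixes K V Z :: "'a::euclidean_space set"
  assumes fin: "finite J" and K: "K \<in> lmeasurable" and V: "V \<in> lmeasurable" and Z: "negligible Z"
    and C: "\<And>i. i \<in> J \<Longrightarrow> C i \<in> lmeasurable" "disjoint_family_on C J" "(\<Union>i\<in>J. C i) \<subseteq> V"
    and sub: "K \<subseteq> Z \<union> (\<Union>i\<in>J. C i)" and \<kappa>: "\<kappa> \<ge> 0"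
    and thin: "\<And>i. i \<in> J \<Longrightarrow> measure lebesgue (K \<inter> C i) \<le> \<kappa> * measure lebesgue (C i)"
  shows "measure lebesgue K \<le> \<kappa> * measure lebesgue V"
proof -
  have KC: "K \<inter> C i \<in> lmeasurable" if "i \<in> J" for i using K C(1)[OF that] by (rule fmeasurable.Int)
  have U: "(\<Union>i\<in>J. K \<inter> C i) \<in> lmeasurable" using fin KC by (rule fmeasurable.finite_UN)
  have Zm: "Z \<in> lmeasurable" "measure lebesgue Z = 0"
    using Z by (simp_all add: negligible_imp_measurable negligible_imp_measure0)
  have "measure lebesgue K \<le> measure lebesgue (Z \<union> (\<Union>i\<in>J. K \<inter> C i))"
    by (rule measure_mono_fmeasurable[OF _ fmeasurableD[OF K] fmeasurable.Un[OF Zm(1) U]]) (use sub in blast)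
  also have "\<dots> \<le> measure lebesgue Z + measure lebesgue (\<Union>i\<in>J. K \<inter> C i)"
    by (rule measure_Un_le[OF fmeasurableD[OF Zm(1)] fmeasurableD[OF U]])
  also have "\<dots> \<le> (\<Sum>i\<in>J. measure lebesgue (K \<inter> C i))"
    using measure_UNION_le[OF fin fmeasurableD[OF KC]] Zm(2) by simp
  also have "\<dots> \<le> (\<Sum>i\<in>J. \<kappa> * measure lebesgue (C i))"
    by (rule sum_mono[OF thin])
  also have "\<dots> = \<kappa> * measure lebesgue (\<Union>i\<in>J. C i)"
  proof -
    have "measure lebesgue (\<Union>i\<in>J. C i) = (\<Sum>i\<in>J. measure lebesgue (C i))"
    proof (rule measure_finite_Union[OF fin _ C(2)])
      show "emeasure lebesgue (C i) \<noteq> \<infinity>" if "i \<in> J" for i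
        using fmeasurableD2[OF C(1)[OF that]] unfolding infinity_ennreal_def .
    qed (use fmeasurableD[OF C(1)] in blast)
    then show ?thesis by (simp add: sum_distrib_left)
  qed
  also have "\<dots> \<le> \<kappa> * measure lebesgue V"
    using fin C(1,3) V \<kappa> by (intro mult_left_mono measure_mono_fmeasurable) (auto intro!: sets.finite_UN fmeasurableD)
  finally show ?thesis .
qed

text \<open>On a fine grid all cells meeting K lie in an open V that is only slightly larger than K.
  If each were filled to at most the fraction \<open>\<kappa>\<close>, then K would have measure at
  most \<open>\<kappa> * measure lebesgue V\<close>, which is less than its own.\<close>

lemma dense_cell:
  fixes K :: "real set"
  assumes K: "compact K" "K \<subseteq> {0..1}" "measure lebesgue K > 0" and \<kappa>: "0 < \<kappa>" "\<kappa> < 1"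
  shows "\<forall>\<^sub>F N in sequentially. \<exists>i<N.
    measure lebesgue (K \<inter> {real i / real N..<(real i + 1) / real N}) > \<kappa> / real N"
proof -
  have Km: "K \<in> lmeasurable" using K(1) by (rule lmeasurable_compact)
  \<comment> \<open>With this excess, \<open>measure lebesgue K\<close> minus
    \<open>\<kappa> * (measure lebesgue K + e)\<close> is
    \<open>(1 - \<kappa>)\<^sup>2 * measure lebesgue K\<close>.\<close>
  define e where "e = (1 - \<kappa>) * measure lebesgue K"
  have "e > 0" using K(3) \<kappa> by (simp add: e_def)
  obtain V where V: "open V" "K \<subseteq> V" "V - K \<in> lmeasurable" "emeasure lebesgue (V - K) < ennreal e"
    using sets_lebesgue_outer_open[of K e] Km \<open>e > 0\<close> by blast
  have Vm: "V \<in> lmeasurable" and mV: "measure lebesgue V < measure lebesgue K + e"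
  proof -
    have eq: "V = K \<union> (V - K)" using V(2) by blast
    show "V \<in> lmeasurable" by (subst eq) (intro fmeasurable.Un Km V(3))
    have "measure lebesgue V \<le> measure lebesgue K + measure lebesgue (V - K)"
      by (subst eq) (rule measure_Un_le, use Km V(3) in auto)
    also have "measure lebesgue (V - K) < e"
      using V(4) \<open>e > 0\<close> unfolding emeasure_eq_measure2[OF V(3)] by (simp add: ennreal_less_iff)
    finally show "measure lebesgue V < measure lebesgue K + e" by simp
  qed
  obtain \<delta> where \<delta>: "\<delta> > 0" "(\<Union>x\<in>K. ball x \<delta>) \<subseteq> V"
    using compact_subset_open_imp_ball_epsilon_subset[OF K(1) V(1,2)] by blast
  obtain N0 :: nat where N0: "N0 > 0" "inverse (real N0) < \<delta>" using ex_inverse_of_nat_less[OF \<delta>(1)] by blast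
  have "\<exists>i<N. measure lebesgue (K \<inter> {real i / real N..<(real i + 1) / real N}) > \<kappa> / real N"
    if N: "N \<ge> N0" for N
  proof (rule ccontr)
    assume contra: "\<not> ?thesis"
    define C where "C = (\<lambda>i::nat. {real i / real N..<(real i + 1) / real N})"
    define J where "J = {i. i < N \<and> K \<inter> C i \<noteq> {}}"
    have N1: "real N > 0" "1 / real N < \<delta>"
      using N N0 le_imp_inverse_le[of "real N0" "real N"] by (auto simp: inverse_eq_divide)
    have mC: "measure lebesgue (C i) = 1 / N" for i
      using N1(1) by (simp add: C_def divide_right_mono field_simps)
    have "measure lebesgue K \<le> \<kappa> * measure lebesgue V"
    \<comment> \<open>The half-open cells leave out the point 1 of the unit interval; this is the
      set Z.\<close>
    proof (rule measure_le_of_thin_cells[where Z = "{1}" and C = C and J = J])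
      show "C i \<in> lmeasurable" for i unfolding C_def by (rule lmeasurable_atLeastLessThan)
      show "disjoint_family_on C J"
      proof (unfold disjoint_family_on_def, intro ballI impI)
        fix i j :: nat assume "i \<noteq> j"
        then have "real i + 1 \<le> real j \<or> real j + 1 \<le> real i" by linarith
        then have "(real i + 1) / N \<le> real j / N \<or> (real j + 1) / N \<le> real i / N"
          using N1(1) by (simp add: divide_le_cancel)
        then show "C i \<inter> C j = {}" by (auto simp: C_def)
      qed
      show "(\<Union>i\<in>J. C i) \<subseteq> V"
      proof
        fix y assume "y \<in> (\<Union>i\<in>J. C i)"
        then obtain i where iJ: "i \<in> J" "y \<in> C i" by blast
        then obtain x where x: "x \<in> K" "x \<in> C i" unfolding J_def by blast
        have "(real i + 1) / N = real i / N + 1 / N" by (simp add: add_divide_distrib)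
        then have "\<bar>x - y\<bar> < 1 / N" using iJ(2) x(2) unfolding C_def atLeastLessThan_iff by linarith
        then have "y \<in> ball x \<delta>" using N1(2) by (simp add: dist_real_def)
        then show "y \<in> V" using \<delta>(2) x(1) by blast
      qed
      show "K \<subseteq> {1} \<union> (\<Union>i\<in>J. C i)"
      proof
        fix x assume x: "x \<in> K"
        show "x \<in> {1} \<union> (\<Union>i\<in>J. C i)"
        proof (cases "x = 1")
          case False
          then have x01: "0 \<le> x" "x < 1" using x K(2) by force+
          define i where "i = nat \<lfloor>x * N\<rfloor>"
          have i: "real i \<le> x * N" "x * N < real i + 1"
            using x01 N1(1) by (auto simp: i_def)
          have "real i < N"
            using i(1) x01 N1(1) mult_strict_right_mono[of x 1 "real N"] by linarith
          moreover have "x \<in> C i" using i N1(1) by (auto simp: C_def field_simps)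
          ultimately show ?thesis using x by (auto simp: J_def)
        qed simp
      qed
      show "measure lebesgue (K \<inter> C i) \<le> \<kappa> * measure lebesgue (C i)" if "i \<in> J" for i
      proof -
        have "i < N" using that by (simp add: J_def)
        then have "\<not> measure lebesgue (K \<inter> C i) > \<kappa> / real N" using contra unfolding C_def by blast
        then show ?thesis unfolding mC by simp
      qed
    qed (use Km Vm \<kappa> in \<open>auto simp: J_def\<close>)
    also have "\<dots> < \<kappa> * (measure lebesgue K + e)" using mV \<kappa>(1) by simp
    also have "\<dots> \<le> measure lebesgue K"
    proof -
      have "measure lebesgue K - \<kappa> * (measure lebesgue K + e) = (1 - \<kappa>)\<^sup>2 * measure lebesgue K"
        by (simp add: e_def power2_eq_square algebra_simps)
      also have "\<dots> \<ge> 0" by simp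
      finally show ?thesis by simp
    qed
    finally show False by simp
  qed
  then show ?thesis unfolding eventually_sequentially by blast
qed

section \<open>The negative integral produced by a single detour\<close>

definition detour :: "real \<Rightarrow> real \<Rightarrow> real \<Rightarrow> complex"
  where "detour b h r = (if r < b then 1 else if r < b + h then \<i> else if r < b + 2 * h then - 1
    else if r < b + 3 * h then - \<i> else 1)"

text \<open>As a velocity, \<open>detour b h\<close> moves in direction 1 but runs through three
  sides of a square of side h: up, back, down. For it the height G vanishes before and after the
  square, the vertical sides have \<open>Re w = 0\<close>, and the backward side at height h
  contributes \<open>- (h ^ 3)\<close>. Changing the velocity on E costs at most
  \<open>6 * \<tau>\<close>.\<close>

lemma detour_integral:
  fixes w :: "real \<Rightarrow> complex"
  assumes h: "0 \<le> h" "s \<le> b" "b + 3 * h \<le> t" "t - s \<le> 1"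
    and w: "w \<in> borel_measurable lebesgue" "\<And>r. norm (w r) \<le> 1"
    and E: "E \<in> lmeasurable" "measure lebesgue E \<le> \<tau>"
    and eq: "\<And>r. r \<in> {s..t} \<Longrightarrow> r \<notin> E \<Longrightarrow> w r = detour b h r"
  shows "integral {s..t} (\<lambda>r. (Im (integral {s..r} w))\<^sup>2 * Re (w r)) \<le> - (h ^ 3) + 6 * \<tau>"
proof -
  define G where "G = (\<lambda>r. Im (integral {s..r} w))"
  \<comment> \<open>The vertical part of the unperturbed detour; its primitive is the height that G
    is compared with.\<close>
  define q0 :: "real \<Rightarrow> real" where "q0 = (\<lambda>r. indicator {b..<b + h} r - indicator {b + 2 * h..<b + 3 * h} r)"
  have "\<tau> \<ge> 0" using E(2) measure_nonneg[of lebesgue E] by linarith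
  have "h \<le> 1" using h by linarith
  have wi: "w integrable_on {c..d}" for c d
    using integrable_on_bounded_measurable[of w c d 1] w
    by (auto simp: measurable_restrict_space1 absolutely_integrable_on_def)
  have q0: "Im (detour b h r) = q0 r" for r
    using h by (auto simp: detour_def q0_def indicator_def)
  have q0i: "q0 integrable_on {s..r}" for r
    unfolding q0_def by (intro integrable_diff integral_indicator_le lmeasurable_atLeastLessThan)
  have Gq: "\<bar>G r - integral {s..r} q0\<bar> \<le> 2 * \<tau>" if "r \<in> {s..t}" for r
  proof -
    have Iw: "(\<lambda>x. Im (w x)) integrable_on {s..r}"
      using integrable_linear[OF wi bounded_linear_Im] by (simp add: o_def)
    have "G r - integral {s..r} q0 = integral {s..r} (\<lambda>x. Im (w x) - q0 x)"
      unfolding G_def Im_integral[OF wi] by (rule integral_diff[symmetric, OF Iw q0i])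
    also have "norm \<dots> \<le> integral {s..r} (\<lambda>x. 2 * indicator E x)"
    proof (rule integral_norm_bound_integral)
      fix x assume x: "x \<in> {s..r}"
      show "norm (Im (w x) - q0 x) \<le> 2 * indicator E x"
      proof (cases "x \<in> E")
        case True
        have "\<bar>q0 x\<bar> \<le> 1" using h by (auto simp: q0_def indicator_def)
        moreover have "\<bar>Im (w x)\<bar> \<le> 1" using abs_Im_le_cmod[of "w x"] w(2)[of x] by linarith
        ultimately show ?thesis using True by simp
      next
        case False
        then have "w x = detour b h x" using eq x that by auto
        then show ?thesis using False q0 by simp
      qed
    qed (use Iw q0i E(1) in \<open>auto intro!: integrable_diff integrable_on_mult_right integral_indicator_le\<close>)
    also have "\<dots> \<le> 2 * \<tau>"
      using integral_indicator_le(2)[OF E(1), of s r] E(2) by simp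
    finally show ?thesis by simp
  qed
  have ind: "integral {s..r} (indicator {c..<d}) = measure lebesgue ({c..<d} \<inter> {s..r})" for c d r :: real
    by (subst integral_indicator) (auto simp: Int_commute intro!: fmeasurable.Int lmeasurable_atLeastLessThan)
  have intq0: "integral {s..r} q0
      = measure lebesgue ({b..<b + h} \<inter> {s..r}) - measure lebesgue ({b + 2 * h..<b + 3 * h} \<inter> {s..r})" for r
    unfolding q0_def by (subst integral_diff) (auto simp: ind intro!: integral_indicator_le lmeasurable_atLeastLessThan)
  have q0_a: "integral {s..r} q0 = 0" if "r < b" for r
  proof -
    have "{b..<b + h} \<inter> {s..r} = {}" "{b + 2 * h..<b + 3 * h} \<inter> {s..r} = {}" using that h by auto
    then show ?thesis unfolding intq0 by simp
  qed
  have q0_b: "integral {s..r} q0 = h" if "b + h \<le> r" "r < b + 2 * h" for r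
  proof -
    have "{b..<b + h} \<inter> {s..r} = {b..<b + h}" "{b + 2 * h..<b + 3 * h} \<inter> {s..r} = {}" using that h by auto
    then show ?thesis unfolding intq0 using h by simp
  qed
  have q0_c: "integral {s..r} q0 = 0" if "b + 3 * h \<le> r" for r
  proof -
    have "{b..<b + h} \<inter> {s..r} = {b..<b + h}"
      "{b + 2 * h..<b + 3 * h} \<inter> {s..r} = {b + 2 * h..<b + 3 * h}" using that h by auto
    then show ?thesis unfolding intq0 using h by simp
  qed
  have G1: "\<bar>G r\<bar> \<le> 1" if "r \<in> {s..t}" for r
  proof -
    have "norm (integral {s..r} w) \<le> integral {s..r} (\<lambda>_. 1)"
      by (rule integral_norm_bound_integral) (use wi w(2) in auto)
    also have "\<dots> \<le> 1" using that h by simp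
    finally show ?thesis unfolding G_def using abs_Im_le_cmod order_trans by blast
  qed
  \<comment> \<open>On E the left side is at most 1 and \<open>h\<^sup>2\<close> is at most 1, which
    \<open>2 * indicator E r\<close> absorbs. Off E the height is within \<open>2 * \<tau>\<close>
    of the unperturbed one, and \<open>4 * \<tau>\<close> bounds the effect on its square. Over a
    length of at most 1 both errors integrate to at most \<open>6 * \<tau>\<close>.\<close>
  have pt: "(G r)\<^sup>2 * Re (w r) \<le> (- h\<^sup>2) * indicator {b + h..<b + 2 * h} r + 4 * \<tau> + 2 * indicator E r"
    if r: "r \<in> {s..t}" for r
  proof (cases "r \<in> E")
    case True
    have "(G r)\<^sup>2 * Re (w r) \<le> 1 * 1"
      using G1[OF r] complex_Re_le_cmod[of "w r"] w(2)[of r]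
      by (intro order_trans[OF mult_left_mono mult_right_mono]) (auto simp: abs_square_le_1)
    moreover have "h\<^sup>2 * indicator {b + h..<b + 2 * h} r \<le> 1 * 1"
      using h \<open>h \<le> 1\<close> by (intro mult_mono) (auto simp: power_le_one indicator_def)
    ultimately show ?thesis using True \<open>\<tau> \<ge> 0\<close> by simp
  next
    case False
    have sq: "(G r)\<^sup>2 \<le> 4 * \<tau>" if "integral {s..r} q0 = 0"
    proof -
      have "\<bar>G r\<bar> * \<bar>G r\<bar> \<le> 1 * (2 * \<tau>)"
        using Gq[OF r] G1[OF r] that \<open>\<tau> \<ge> 0\<close> by (intro mult_mono) auto
      then show ?thesis using \<open>\<tau> \<ge> 0\<close> by (simp add: power2_eq_square abs_mult_self_eq)
    qed
    consider "r < b" | "b \<le> r" "r < b + h" | "b + h \<le> r" "r < b + 2 * h"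
      | "b + 2 * h \<le> r" "r < b + 3 * h" | "b + 3 * h \<le> r" by linarith
    then show ?thesis
    proof cases
      case 3
      \<comment> \<open>Factorising \<open>h\<^sup>2 - (G r)\<^sup>2\<close> keeps the error on the
        backward side linear in \<open>\<tau>\<close>.\<close>
      have "(h - G r) * (h + G r) \<le> (2 * \<tau>) * 2"
      proof -
        have "(h - G r) * (h + G r) \<le> \<bar>h - G r\<bar> * \<bar>h + G r\<bar>"
          by (metis abs_ge_self abs_mult)
        also have "\<dots> \<le> (2 * \<tau>) * 2"
          using Gq[OF r] G1[OF r] q0_b[OF 3] h \<open>h \<le> 1\<close> \<open>\<tau> \<ge> 0\<close> by (intro mult_mono) auto
        finally show ?thesis .
      qed
      then show ?thesis
        using 3 False h eq[OF r False] by (simp add: detour_def power2_eq_square algebra_simps)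
    qed (use False h eq[OF r False] sq q0_a q0_c \<open>\<tau> \<ge> 0\<close> in \<open>auto simp: detour_def\<close>)
  qed
  have "integral {s..t} (\<lambda>r. (G r)\<^sup>2 * Re (w r))
      \<le> integral {s..t} (\<lambda>r. (- h\<^sup>2) * indicator {b + h..<b + 2 * h} r + 4 * \<tau> + 2 * indicator E r)"
  proof (rule integral_le)
    have "continuous_on {s..t} G"
      unfolding G_def by (intro continuous_intros indefinite_integral_continuous_1 wi)
    then have "G \<in> borel_measurable (lebesgue_on {s..t})"
      by (rule continuous_imp_measurable_on_sets_lebesgue) auto
    moreover have "w \<in> borel_measurable (lebesgue_on {s..t})" using w(1) by (rule measurable_restrict_space1)
    ultimately have "(\<lambda>r. (G r)\<^sup>2 * Re (w r)) \<in> borel_measurable (lebesgue_on {s..t})" by measurable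
    moreover have "norm ((G r)\<^sup>2 * Re (w r)) \<le> 1" if "r \<in> {s..t}" for r
    proof -
      have "\<bar>Re (w r)\<bar> \<le> 1" using abs_Re_le_cmod[of "w r"] w(2)[of r] by linarith
      then have "(G r)\<^sup>2 * \<bar>Re (w r)\<bar> \<le> 1 * 1"
        using G1[OF that] by (intro mult_mono) (auto simp: abs_square_le_1)
      then show ?thesis by (simp add: abs_mult)
    qed
    ultimately show "(\<lambda>r. (G r)\<^sup>2 * Re (w r)) integrable_on {s..t}"
      using integrable_on_bounded_measurable absolutely_integrable_on_def by blast
    show "(\<lambda>r. (- h\<^sup>2) * indicator {b + h..<b + 2 * h} r + 4 * \<tau> + 2 * indicator E r) integrable_on {s..t}"
      by (intro integrable_add integrable_on_mult_right integral_indicator_le lmeasurable_atLeastLessThan E(1))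
        auto
  qed (rule pt)
  also have "\<dots> = (- h\<^sup>2) * integral {s..t} (indicator {b + h..<b + 2 * h}) + 4 * \<tau> * (t - s)
      + 2 * integral {s..t} (indicator E)"
  proof -
    have i1: "(\<lambda>r. (- h\<^sup>2) * indicator {b + h..<b + 2 * h} r) integrable_on {s..t}"
      and i2: "(\<lambda>r. 2 * indicator E r :: real) integrable_on {s..t}"
      by (intro integrable_on_mult_right integral_indicator_le lmeasurable_atLeastLessThan E(1))+
    have i3: "(\<lambda>r. 4 * \<tau>) integrable_on {s..t}" by (rule integrable_const_ivl)
    show ?thesis
      unfolding integral_add[OF integrable_add[OF i1 i3] i2] integral_add[OF i1 i3] integral_mult_right
      using h by simp
  qed
  also have "integral {s..t} (indicator {b + h..<b + 2 * h}) = h"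
  proof -
    have "{b + h..<b + 2 * h} \<inter> {s..t} = {b + h..<b + 2 * h}" using h by auto
    then show ?thesis unfolding ind using h by simp
  qed
  also have "(- h\<^sup>2) * h + 4 * \<tau> * (t - s) + 2 * integral {s..t} (indicator E) \<le> (- h\<^sup>2) * h + 4 * \<tau> * 1 + 2 * \<tau>"
    using integral_indicator_le(2)[OF E(1), of s t] E(2) h \<open>\<tau> \<ge> 0\<close>
    by (intro add_mono mult_left_mono order_refl) auto
  finally show ?thesis unfolding G_def by (simp add: power3_eq_cube power2_eq_square algebra_simps)
qed

section \<open>The nested grids and the control built on them\<close>

fun grid :: "nat \<Rightarrow> nat" where
  "grid 0 = 1"
| "grid (Suc n) = grid n * (200 * grid n ^ 3 + 3)"

text \<open>Each cell of the grid of level \<open>k\<close> has \<open>200 * grid k ^ 3 + 3\<close> subcells. The factor \<open>rot k\<close> turns the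
  direction on the three middle ones, which form the detour. The exponent \<open>3\<close> makes the total length of
  all finer detours small compared with the gain \<open>h ^ 3\<close> of a detour with side \<open>h\<close>.\<close>
definition rot :: "nat \<Rightarrow> real \<Rightarrow> complex"
  where "rot k t = (let j = \<lfloor>real (grid (Suc k)) * t\<rfloor> mod int (200 * grid k ^ 3 + 3) - int (100 * grid k ^ 3)
     in if j = 0 then \<i> else if j = 1 then - 1 else if j = 2 then - \<i> else 1)"

text \<open>The product over an infinite set is \<open>1\<close>; this happens only on a null set.\<close>
definition control :: "real \<Rightarrow> complex"
  where "control t = prod (\<lambda>k. rot k t) {k. rot k t \<noteq> 1}"

text \<open>The places where level n or a finer level may disturb the pattern of the coarser
  levels.\<close>

definition modified :: "nat \<Rightarrow> real set"
  where "modified n = {t \<in> {0..1}. \<exists>k\<ge>n. rot k t \<noteq> 1}"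

lemma grid_pos: "grid n > 0"
  by (induction n) auto

declare grid.simps(2) [simp del]

lemma real_grid_Suc: "real (grid (Suc n)) = real (grid n) * (200 * real (grid n) ^ 3 + 3)"
  by (simp add: grid.simps(2))

lemma branch_pos: "0 < 200 * real (grid n) ^ 3 + 3"
  by (simp add: add_nonneg_pos)

lemma grid_Suc_ge: "grid (Suc n) \<ge> 2 * grid n"
  by (simp add: grid.simps(2))

lemma grid_add_ge: "2 ^ j * grid n \<le> grid (n + j)"
proof (induction j)
  case (Suc j)
  then show ?case using grid_Suc_ge[of "n + j"] by simp
qed simp

lemma filterlim_grid: "filterlim grid at_top sequentially"
proof (rule filterlim_at_top_mono[of "\<lambda>n. n"])
  show "\<forall>\<^sub>F n in sequentially. n \<le> grid n"
  proof (intro always_eventually allI)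
    show "n \<le> grid n" for n
      using grid_add_ge[of n 0] less_imp_le[OF less_exp[of n]] by (simp add: order_trans[of n "2 ^ n"])
  qed
qed (rule filterlim_ident)

lemma rot_range: "rot k t \<in> {1, \<i>, - 1, - \<i>}"
  by (simp add: rot_def Let_def)

lemma prod_rot_range: "prod (\<lambda>k. rot k t) A \<in> {1, \<i>, - 1, - \<i>}"
proof (induction A rule: infinite_finite_induct)
  case (insert k A)
  then show ?case using rot_range[of k t] by auto
qed auto

lemma control_range: "control t \<in> {1, \<i>, - 1, - \<i>}"
  unfolding control_def by (rule prod_rot_range)

lemma norm_control [simp]: "norm (control t) = 1"
  using control_range[of t] by auto

lemma control_eq_prod:
  assumes "t \<in> {0..1}" "t \<notin> modified n"
  shows "control t = (\<Prod>k<n. rot k t)"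
proof -
  have "{k. rot k t \<noteq> 1} \<subseteq> {..<n}"
    using assms not_less by (auto simp: modified_def)
  then show ?thesis
    unfolding control_def by (intro prod.mono_neutral_left) auto
qed

text \<open>The grids are nested: the index of a cell of level n is the integer quotient of the
  index on level \<open>Suc n\<close> by the number of subcells.\<close>

lemma floor_grid_Suc:
  assumes "\<lfloor>real (grid (Suc n)) * s\<rfloor> = \<lfloor>real (grid (Suc n)) * t\<rfloor>"
  shows "\<lfloor>real (grid n) * s\<rfloor> = \<lfloor>real (grid n) * t\<rfloor>"
proof -
  have "\<lfloor>real (grid n) * x\<rfloor> = \<lfloor>real (grid (Suc n)) * x\<rfloor> div int (200 * grid n ^ 3 + 3)" for x
  proof -
    have "real (grid n) * x = real (grid (Suc n)) * x / of_int (int (200 * grid n ^ 3 + 3))"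
      by (simp add: real_grid_Suc) (use branch_pos[of n] in linarith)
    then show ?thesis using floor_divide_real_eq_div[of "int (200 * grid n ^ 3 + 3)"] by simp
  qed
  then show ?thesis using assms by simp
qed

text \<open>The levels below n see a point only through its cell of level n, so on such a cell they
  contribute one constant direction.\<close>

lemma prod_rot_cong:
  assumes "\<lfloor>real (grid n) * s\<rfloor> = \<lfloor>real (grid n) * t\<rfloor>"
  shows "(\<Prod>k<n. rot k s) = (\<Prod>k<n. rot k t)"
  using assms
proof (induction n)
  case (Suc n)
  have "rot n s = rot n t" unfolding rot_def Suc.prems ..
  then show ?case using Suc.IH[OF floor_grid_Suc[OF Suc.prems]] by simp
qed simp

text \<open>Among the \<open>200 * grid n ^ 3 + 3\<close> subcells of a cell, the rotated ones are
  preceded and followed by \<open>100 * grid n ^ 3\<close> others; each has length h and forms one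
  side of the square.\<close>

lemma rot_eq_detour:
  assumes t: "real i / grid n \<le> t" "t < (real i + 1) / grid n"
  defines "h \<equiv> 1 / real (grid (Suc n))"
  shows "rot n t = detour (real i / grid n + 100 * real (grid n) ^ 3 * h) h t"
proof -
  define S M where "S = real (grid (Suc n))" and "M = 200 * grid n ^ 3 + 3"
  have S: "S > 0" "S = grid n * M" using grid_pos[of "Suc n"] by (simp only: S_def of_nat_0_less_iff) (simp add: S_def M_def real_grid_Suc)
  have sn: "real (grid n) > 0" using grid_pos by simp
  \<comment> \<open>The number of the subcell that contains t, counted from 0 within cell i.\<close>
  define j where "j = \<lfloor>S * t\<rfloor> - int i * int M"
  have a: "S * (real i / grid n) = real i * M" using sn by (simp add: S(2))
  have "real i * M \<le> S * t" using t(1) mult_left_mono[of _ t S] S(1) a by fastforce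
  then have "int i * int M \<le> \<lfloor>S * t\<rfloor>" by (simp add: le_floor_iff)
  then have j0: "0 \<le> j" by (simp add: j_def)
  have "S * t < S * ((real i + 1) / grid n)" by (rule mult_strict_left_mono[OF t(2) S(1)])
  also have "\<dots> = (real i + 1) * M" using sn by (simp add: S(2))
  finally have "\<lfloor>S * t\<rfloor> < (int i + 1) * int M" by (simp add: floor_less_iff)
  then have jM: "j < int M" by (simp add: j_def algebra_simps)
  have mod: "\<lfloor>S * t\<rfloor> mod int M = j"
  proof -
    have "\<lfloor>S * t\<rfloor> mod int M = (j + int i * int M) mod int M" by (simp add: j_def)
    also have "\<dots> = j" using j0 jM by simp
    finally show ?thesis .
  qed
  \<comment> \<open>The break points of the detour are grid points of level \<open>Suc n\<close>, so
    comparing t with them amounts to comparing j with an integer. The values 0 to 3 of c give the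
    four case distinctions of \<open>detour\<close>.\<close>
  have cmp: "t < real i / grid n + 100 * real (grid n) ^ 3 * h + c * h
      \<longleftrightarrow> j < int (100 * grid n ^ 3) + c" for c :: int
  proof -
    have "t < real i / grid n + 100 * real (grid n) ^ 3 * h + c * h
      \<longleftrightarrow> S * t < S * (real i / grid n + 100 * real (grid n) ^ 3 * h + c * h)"
      using S(1) by simp
    also have "S * (real i / grid n + 100 * real (grid n) ^ 3 * h + c * h)
       = real_of_int (int i * int M + int (100 * grid n ^ 3) + c)"
      unfolding distrib_left a using S(1) by (simp add: h_def S_def[symmetric])
    also have "S * t < real_of_int (int i * int M + int (100 * grid n ^ 3) + c)
      \<longleftrightarrow> j < int (100 * grid n ^ 3) + c"
      unfolding j_def floor_less_iff[symmetric] by linarith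
    finally show ?thesis .
  qed
  show ?thesis
    using cmp[of 0] cmp[of 1] cmp[of 2] cmp[of 3]
    unfolding rot_def S_def[symmetric] M_def[symmetric] mod detour_def Let_def by auto
qed

lemma measurable_rot [measurable]: "rot k \<in> borel_measurable borel"
proof -
  define g :: "int \<Rightarrow> complex" where "g = (\<lambda>m. let j = m mod int (200 * grid k ^ 3 + 3) - int (100 * grid k ^ 3)
     in if j = 0 then \<i> else if j = 1 then - 1 else if j = 2 then - \<i> else 1)"
  have "rot k = (\<lambda>t. g \<lfloor>real (grid (Suc k)) * t\<rfloor>)" by (simp add: rot_def g_def fun_eq_iff)
  also have "\<dots> \<in> borel_measurable borel" by measurable
  finally show ?thesis .
qed

lemma measurable_modified [measurable]: "modified n \<in> sets borel"
proof -
  have "modified n = {0..1} \<inter> (\<Union>k\<in>{n..}. {t \<in> space borel. rot k t \<noteq> 1})"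
    by (auto simp: modified_def)
  also have "\<dots> \<in> sets borel" by measurable
  finally show ?thesis .
qed

text \<open>Level k rotates three subcells of length \<open>1 / grid (Suc k)\<close> in each of its
  cells, a total of order \<open>1 / grid k ^ 3\<close>. As the grid at least doubles with each
  level, the levels from n on are dominated by a geometric series with ratio 1 / 8.\<close>

lemma measure_modified:
  shows "modified n \<in> lmeasurable"
    and "measure lebesgue (modified n) \<le> 1 / (25 * real (grid n) ^ 3)"
proof -
  define R where "R = (\<lambda>k. {t \<in> {0..1}. rot k t \<noteq> 1})"
  have Rm: "R k \<in> lmeasurable" for k
  proof (rule bounded_set_imp_lmeasurable)
    have "R k = {0..1} \<inter> {t \<in> space borel. rot k t \<noteq> 1}" by (auto simp: R_def)
    also have "\<dots> \<in> sets borel" by measurable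
    finally show "R k \<in> sets lebesgue" by simp
  qed (auto simp: R_def intro: bounded_subset[of "{0..1}"])
  have mR: "measure lebesgue (R k) \<le> 6 / (200 * real (grid k) ^ 3)" for k
  proof -
    define h b where "h = 1 / real (grid (Suc k))"
      and "b = (\<lambda>i::nat. real i / grid k + 100 * real (grid k) ^ 3 * h)"
    have sk: "real (grid k) > 0" using grid_pos by simp
    have h: "h > 0" using grid_pos[of "Suc k"] by (simp add: h_def)
    \<comment> \<open>The index \<open>grid k\<close> accounts for \<open>t = 1\<close>, which lies
      in no half-open cell of smaller index.\<close>
    have sub: "R k \<subseteq> (\<Union>i\<in>{..grid k}. {b i..<b i + 3 * h})"
    proof
      fix t assume t: "t \<in> R k"
      define i where "i = nat \<lfloor>grid k * t\<rfloor>"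
      have t01: "0 \<le> t" "t \<le> 1" using t by (auto simp: R_def)
      have i: "real i \<le> grid k * t" "grid k * t < real i + 1"
        using t01 by (auto simp: i_def)
      have "real i \<le> grid k" using i(1) t01 mult_left_mono[of t 1 "real (grid k)"] by simp
      then have "i \<le> grid k" by simp
      moreover have "rot k t = detour (b i) h t"
        unfolding b_def h_def using i sk by (intro rot_eq_detour) (auto simp: field_simps)
      then have "detour (b i) h t \<noteq> 1" using t by (simp add: R_def)
      then have "t \<in> {b i..<b i + 3 * h}" using h by (auto simp: detour_def split: if_splits)
      ultimately show "t \<in> (\<Union>i\<in>{..grid k}. {b i..<b i + 3 * h})" by blast
    qed
    have "measure lebesgue (R k) \<le> measure lebesgue (\<Union>i\<in>{..grid k}. {b i..<b i + 3 * h})"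
      using Rm by (intro measure_mono_fmeasurable[OF sub] fmeasurable.finite_UN)
        (auto simp: fmeasurableD intro: lmeasurable_atLeastLessThan)
    also have "\<dots> \<le> (\<Sum>i\<in>{..grid k}. measure lebesgue {b i..<b i + 3 * h})"
      by (intro measure_UNION_le) auto
    also have "\<dots> = (real (grid k) + 1) * (3 * h)" using h by simp
    also have "\<dots> \<le> (2 * real (grid k)) * (3 * h)"
      using h sk by (intro mult_right_mono) auto
    also have "\<dots> = 6 / (200 * real (grid k) ^ 3 + 3)"
      using sk by (simp add: h_def real_grid_Suc)
    also have "\<dots> \<le> 6 / (200 * real (grid k) ^ 3)"
      using sk by (intro divide_left_mono) (auto intro!: mult_pos_pos add_pos_pos)
    finally show ?thesis .
  qed
  have bound: "measure lebesgue (\<Union>k\<in>I. R (n + k)) \<le> 1 / (25 * real (grid n) ^ 3)" if "finite I" for I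
  proof -
    have sn: "real (grid n) > 0" using grid_pos by simp
    have "measure lebesgue (\<Union>k\<in>I. R (n + k)) \<le> (\<Sum>k\<in>I. measure lebesgue (R (n + k)))"
      using Rm by (intro measure_UNION_le that) (auto simp: fmeasurableD)
    also have "\<dots> \<le> (\<Sum>k\<in>I. 6 / (200 * real (grid n) ^ 3) * (1 / 8) ^ k)"
    proof (rule sum_mono)
      fix k
      have "real (2 ^ k * grid n) \<le> real (grid (n + k))" using grid_add_ge of_nat_le_iff by blast
      then have "(2 ^ k * real (grid n)) ^ 3 \<le> real (grid (n + k)) ^ 3"
        by (intro power_mono) auto
      then have "6 / (200 * real (grid (n + k)) ^ 3) \<le> 6 / (200 * (2 ^ k * real (grid n)) ^ 3)"
        using sn grid_pos[of "n + k"] by (intro divide_left_mono) (auto intro!: mult_pos_pos)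
      also have "\<dots> = 6 / (200 * real (grid n) ^ 3) * (1 / 8) ^ k"
        by (simp add: power_mult_distrib power_divide power_mult[symmetric] mult.commute[of k])
          (simp add: power_mult)
      finally show "measure lebesgue (R (n + k)) \<le> 6 / (200 * real (grid n) ^ 3) * (1 / 8) ^ k"
        using mR[of "n + k"] by linarith
    qed
    also have "\<dots> = 6 / (200 * real (grid n) ^ 3) * (\<Sum>k\<in>I. (1 / 8) ^ k)"
      by (rule sum_distrib_left[symmetric])
    also have "\<dots> \<le> 6 / (200 * real (grid n) ^ 3) * (8 / 7)"
    proof (rule mult_left_mono)
      have "(\<Sum>k\<in>I. (1 / 8 :: real) ^ k) \<le> (\<Sum>k. (1 / 8) ^ k)"
        by (rule sum_le_suminf) (use that in auto)
      also have "\<dots> = 8 / 7" by (subst suminf_geometric) auto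
      finally show "(\<Sum>k\<in>I. (1 / 8 :: real) ^ k) \<le> 8 / 7" .
    qed simp
    \<comment> \<open>Numerically, \<open>6 / 200 * (8 / 7)\<close> is about 0.034, below 1 /
      25.\<close>
    also have "\<dots> \<le> 1 / (25 * real (grid n) ^ 3)" using sn by (simp add: field_simps)
    finally show ?thesis .
  qed
  have "(\<exists>k\<ge>n. rot k t \<noteq> 1) \<longleftrightarrow> (\<exists>k. rot (n + k) t \<noteq> 1)" for t
    by (metis le_add1 le_Suc_ex)
  then have eq: "modified n = (\<Union>k. R (n + k))"
    by (auto simp: modified_def R_def)
  show "modified n \<in> lmeasurable" "measure lebesgue (modified n) \<le> 1 / (25 * real (grid n) ^ 3)"
    unfolding eq
    by (rule fmeasurable_UN_bound[OF _ Rm bound] measure_UN_bound[OF _ Rm bound]; simp)+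
qed

text \<open>On F only finitely many factors differ from 1, and the finite products become
  stationary. Off F the product over an infinite set has the default value 1, which matches the
  constant sequence chosen there.\<close>

lemma measurable_control: "control \<in> borel_measurable borel"
proof -
  define F where "F = {t. \<exists>n. \<forall>k\<ge>n. rot k t = 1}"
  have F[measurable]: "F \<in> sets borel"
  proof -
    have "F = {t \<in> space borel. \<exists>n. \<forall>k. k \<ge> n \<longrightarrow> rot k t = 1}" by (simp add: F_def)
    also have "\<dots> \<in> sets borel" by measurable
    finally show ?thesis .
  qed
  show ?thesis
  proof (rule borel_measurable_LIMSEQ_metric)
    show "(\<lambda>t. if t \<in> F then \<Prod>k<n. rot k t else 1) \<in> borel_measurable borel" for n
      by measurable
    fix t :: real
    show "(\<lambda>n. if t \<in> F then \<Prod>k<n. rot k t else 1) \<longlonglongrightarrow> control t"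
    proof (cases "t \<in> F")
      case True
      then obtain n where n: "\<And>k. k \<ge> n \<Longrightarrow> rot k t = 1" by (auto simp: F_def)
      have "(\<Prod>k<m. rot k t) = control t" if "m \<ge> n" for m
        unfolding control_def
        using n that by (intro prod.mono_neutral_right) (auto simp: not_less[symmetric] intro: ccontr le_trans)
      then have "\<forall>\<^sub>F m in sequentially. (if t \<in> F then \<Prod>k<m. rot k t else 1) = control t"
        using True by (auto simp: eventually_sequentially)
      then show ?thesis by (rule tendsto_eventually)
    next
      case False
      have "infinite {k. rot k t \<noteq> 1}"
      proof
        assume "finite {k. rot k t \<noteq> 1}"
        then obtain m where "\<And>k. rot k t \<noteq> 1 \<Longrightarrow> k < m" 
          by (metis (mono_tags, lifting) finite_nat_set_iff_bounded mem_Collect_eq)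
        then have "\<forall>k\<ge>m. rot k t = 1" by (meson not_less)
        then show False using False by (auto simp: F_def)
      qed
      then show ?thesis using False by (simp add: control_def)
    qed
  qed
qed

text \<open>On a cell of level n the coarser levels give the constant direction d, level n inserts
  the detour, and off \<open>modified (Suc n)\<close> no finer level acts.\<close>

lemma control_eq_detour:
  fixes n i :: nat
  defines "h \<equiv> 1 / real (grid (Suc n))"
  shows "\<exists>d\<in>{1, \<i>, - 1, - \<i>}. \<forall>t. t \<in> {0..1} \<longrightarrow> t \<in> {real i / grid n..<(real i + 1) / grid n} \<longrightarrow>
    t \<notin> modified (Suc n) \<longrightarrow> control t = d * detour (real i / grid n + 100 * real (grid n) ^ 3 * h) h t"
proof (intro bexI allI impI)
  \<comment> \<open>The direction d is read off at the left end point of the cell.\<close>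
  show "(\<Prod>k<n. rot k (real i / grid n)) \<in> {1, \<i>, - 1, - \<i>}" by (rule prod_rot_range)
  fix t assume t: "t \<in> {0..1}" "t \<in> {real i / grid n..<(real i + 1) / grid n}" "t \<notin> modified (Suc n)"
  have "real (grid n) > 0" using grid_pos by simp
  then have "\<lfloor>real (grid n) * t\<rfloor> = \<lfloor>real (grid n) * (real i / grid n)\<rfloor>"
    using t(2) by (simp add: floor_eq_iff field_simps)
  then have "(\<Prod>k<n. rot k t) = (\<Prod>k<n. rot k (real i / grid n))" by (rule prod_rot_cong)
  then show "control t = (\<Prod>k<n. rot k (real i / grid n)) * detour (real i / grid n + 100 * real (grid n) ^ 3 * h) h t"
    using control_eq_prod[OF t(1,3)] rot_eq_detour[of i n t] t(2) by (simp add: h_def)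
qed

lemma control_integrable: "control integrable_on {a..b}"
proof -
  have "control absolutely_integrable_on {a..b}"
    using measurable_control
    by (intro integrable_on_bounded_measurable[where B = 1])
      (auto intro!: measurable_restrict_space1 measurable_completion)
  then show ?thesis by (simp add: absolutely_integrable_on_def)
qed

text \<open>With s and t in the outer quarters of the cell, the whole detour lies between them.
  After rotation by \<open>cnj d\<close> the control is a standard detour up to the finer levels,
  whose measure is too small to outweigh \<open>h ^ 3\<close> or the forward motion.\<close>

lemma control_on_cell:
  fixes n i :: nat
  assumes i: "i < grid n"
    and st: "real i / grid n \<le> s" "s \<le> (real i + 1 / 4) / grid n"
      "(real i + 3 / 4) / grid n \<le> t" "t < (real i + 1) / grid n"
  shows "\<exists>d\<in>{1, \<i>, - 1, - \<i>}.
    integral {s..t} (\<lambda>r. (Im (cnj d * integral {s..r} control))\<^sup>2 * Re (cnj d * control r)) < 0 \<and>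
    (t - s) / 2 \<le> Re (cnj d * integral {s..t} control)"
proof -
  define S m h b where "S = real (grid n)" and "m = 100 * real (grid n) ^ 3"
    and "h = 1 / real (grid (Suc n))" and "b = real i / grid n + 100 * real (grid n) ^ 3 * h"
  have S: "S \<ge> 1" using grid_pos[of n] by (simp add: S_def)
  have m: "m \<ge> 100" using S by (simp add: m_def S_def[symmetric] one_le_power)
  have h: "0 < h" using grid_pos[of "Suc n"] by (simp add: h_def)
  \<comment> \<open>A cell consists of \<open>2 * m + 3\<close> subcells of length h: three for the
    detour and m on either side.\<close>
  have Sh: "1 / S = (2 * m + 3) * h"
    using S branch_pos[of n] by (simp add: h_def real_grid_Suc S_def[symmetric] m_def)
  have b: "b = i * (1 / S) + m * h" by (simp add: b_def S_def m_def)
  obtain d where d: "d \<in> {1, \<i>, - 1, - \<i>}"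
    "\<And>t. t \<in> {0..1} \<Longrightarrow> t \<in> {real i / grid n..<(real i + 1) / grid n} \<Longrightarrow> t \<notin> modified (Suc n) \<Longrightarrow>
      control t = d * detour b h t"
    using control_eq_detour[where n = n and i = i] unfolding h_def[symmetric] b_def[symmetric]
    by (elim bexE) simp
  define w where "w = (\<lambda>t. cnj d * control t)"
  have dd: "cnj d * d = 1" "norm d = 1" using d(1) by auto
  \<comment> \<open>The bound of \<open>measure_modified\<close> for level \<open>Suc n\<close>,
    where \<open>1 / grid (Suc n)\<close> is h.\<close>
  define \<tau> where "\<tau> = h ^ 3 / 25"
  let ?E = "modified (Suc n)"
  have E: "?E \<in> lmeasurable" "measure lebesgue ?E \<le> \<tau>"
    using measure_modified[of "Suc n"] by (simp_all add: \<tau>_def h_def power_divide)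
  have wint: "w integrable_on {p..q}" for p q
    unfolding w_def by (intro integrable_on_mult_right control_integrable)
  have wI: "integral {p..q} w = cnj d * integral {p..q} control" for p q
    unfolding w_def by (rule integral_mult_right)
  have wm: "w \<in> borel_measurable lebesgue"
    unfolding w_def using measurable_control by (intro measurable_completion) simp
  have wn: "norm (w r) \<le> 1" for r using dd by (simp add: w_def norm_mult)
  have h1: "h \<le> 1"
  proof -
    have "grid (Suc n) \<ge> 1" using grid_pos[of "Suc n"] by simp
    then have "real (grid (Suc n)) \<ge> 1" by linarith
    then show ?thesis by (simp add: h_def)
  qed
  then have \<tau>: "0 \<le> \<tau>" "\<tau> \<le> h" "6 * \<tau> < h ^ 3"
    using h power_decreasing[of 1 3 h] by (simp_all add: \<tau>_def)
  \<comment> \<open>Left end and length of the cell, and the length of the straight piece on either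
    side of the detour. In these quantities the remaining inequalities are linear.\<close>
  define X L Y where "X = real i / S" and "L = 1 / S" and "Y = m * h"
  have st': "X \<le> s" "s \<le> X + L / 4" "X + 3 / 4 * L \<le> t" "t < X + L"
    using st by (simp_all add: S_def X_def L_def add_divide_distrib)
  have LY: "L = 2 * Y + 3 * h" using Sh by (simp add: L_def Y_def algebra_simps)
  have bX: "b = X + Y" by (simp add: b X_def Y_def)
  have Y: "100 * h \<le> Y" using m h by (simp add: Y_def)
  have 1: "s \<le> b" "b + 3 * h \<le> t"
    using st' Y h LY bX by linarith+
  have "L \<le> 1" using S by (simp add: L_def)
  then have 2: "t - s \<le> 1" using st' by linarith
  have 3: "50 * h \<le> t - s" "s \<le> t"
    using st' Y h LY by linarith+
  have cell: "r \<in> {0..1}" "r \<in> {real i / grid n..<(real i + 1) / grid n}" if "r \<in> {s..t}" for r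
  proof -
    have "(real i + 1) / grid n \<le> 1" using i by simp
    moreover have "0 \<le> real i / grid n" by simp
    ultimately show "r \<in> {0..1}" using st that unfolding atLeastAtMost_iff by linarith
    show "r \<in> {real i / grid n..<(real i + 1) / grid n}" using st that by auto
  qed
  have eq: "w r = detour b h r" if "r \<in> {s..t}" "r \<notin> ?E" for r
    using d(2)[OF cell[OF that(1)] that(2)] dd(1) by (simp add: w_def mult.assoc[symmetric])
  have "integral {s..t} (\<lambda>r. (Im (integral {s..r} w))\<^sup>2 * Re (w r)) \<le> - (h ^ 3) + 6 * \<tau>"
    by (rule detour_integral[OF _ 1 2 wm wn E eq]) (use h in auto)
  also have "\<dots> < 0" using \<tau> by simp
  finally have neg: "integral {s..t} (\<lambda>r. (Im (cnj d * integral {s..r} control))\<^sup>2 * Re (cnj d * control r)) < 0"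
    unfolding wI by (simp only: w_def)
  \<comment> \<open>A lower bound for \<open>Re (w r)\<close>, which is 1 off the detour and the
    finer levels and at least - 1 everywhere. The loss is at most \<open>2 * \<tau> + 6 * h\<close>,
    well below half of \<open>t - s\<close>, which is at least \<open>50 * h\<close>.\<close>
  let ?f = "\<lambda>r. 1 - (2 * indicator ?E r + 2 * indicator {b..<b + 3 * h} r) :: real"
  have ib: "(\<lambda>r. indicator {b..<b + 3 * h} r :: real) integrable_on {s..t}"
      "integral {s..t} (indicator {b..<b + 3 * h}) \<le> 3 * h"
    using integral_indicator_le[where E = "{b..<b + 3 * h}" and p = s and q = t,
        OF lmeasurable_atLeastLessThan] h by auto
  have "(t - s) / 2 \<le> (t - s) - (2 * \<tau> + 2 * (3 * h))" using 3(1) \<tau>(1,2) h by (simp add: field_simps)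
  also have "\<dots> \<le> (t - s) - (2 * integral {s..t} (indicator ?E) + 2 * integral {s..t} (indicator {b..<b + 3 * h}))"
    using ib(2) integral_indicator_le(2)[OF E(1), of s t] E(2) by linarith
  also have "\<dots> = integral {s..t} ?f"
  proof -
    have i1: "(\<lambda>r. 2 * indicator ?E r :: real) integrable_on {s..t}"
      and i2: "(\<lambda>r. 2 * indicator {b..<b + 3 * h} r :: real) integrable_on {s..t}"
      by (intro integrable_on_mult_right integral_indicator_le(1)[OF E(1)] ib(1))+
    show ?thesis
      unfolding integral_diff[OF integrable_const_ivl integrable_add[OF i1 i2]] integral_add[OF i1 i2]
        integral_mult_right
      using 3(2) by simp
  qed
  also have "\<dots> \<le> integral {s..t} (\<lambda>r. Re (w r))"
  proof (rule integral_le)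
    fix r assume r: "r \<in> {s..t}"
    show "?f r \<le> Re (w r)"
    proof (cases "r \<in> ?E \<or> r \<in> {b..<b + 3 * h}")
      case True
      have "- 1 \<le> Re (w r)" using abs_Re_le_cmod[of "w r"] wn[of r] by linarith
      then show ?thesis using True by (auto simp: indicator_def)
    next
      case False
      then show ?thesis using eq[OF r] h by (auto simp: detour_def)
    qed
  next
    show "?f integrable_on {s..t}"
      using ib(1) integral_indicator_le(1)[OF E(1), of s t]
      by (intro integrable_diff integrable_add integrable_on_mult_right) auto
    show "(\<lambda>r. Re (w r)) integrable_on {s..t}"
      using integrable_linear[OF wint bounded_linear_Re] by (simp add: o_def)
  qed
  also have "\<dots> = Re (cnj d * integral {s..t} control)"
    unfolding Re_integral[OF wint, symmetric] wI ..
  finally have "(t - s) / 2 \<le> Re (cnj d * integral {s..t} control)" .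
  with neg d(1) show ?thesis by blast
qed

section \<open>The horizontal lift\<close>

text \<open>The parameter is clamped to \<open>[0, 1]\<close> so that \<open>position\<close> and \<open>velocity\<close> are bounded on the whole line.\<close>
definition position :: "real \<Rightarrow> complex"
  where "position t = integral {0..max 0 (min 1 t)} control"

text \<open>The fields X1 and X2 depend on the first two coordinates only. Hence zeros may stand for
  the others, and the lift is a plain integral instead of the solution of a differential
  equation.\<close>

definition velocity :: "real \<Rightarrow> real ^ 5"
  where "velocity t = Re (control t) *\<^sub>R X1 (vector [Re (position t), Im (position t), 0, 0, 0])
    + Im (control t) *\<^sub>R X2 (vector [Re (position t), Im (position t), 0, 0, 0])"

definition curve :: "real \<Rightarrow> real ^ 5"
  where "curve t = integral {0..t} velocity"

lemma control_lebesgue: "control \<in> borel_measurable lebesgue"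
  using measurable_control by (intro measurable_completion) simp

lemma continuous_position: "continuous_on UNIV position"
proof -
  have "continuous_on {0..1} (\<lambda>t. integral {0..t} control)"
    by (rule indefinite_integral_continuous_1) (rule control_integrable)
  moreover have "continuous_on UNIV (\<lambda>t::real. max 0 (min 1 t))" by (intro continuous_intros)
  ultimately show ?thesis
    unfolding position_def by (rule continuous_on_compose2[where g = "\<lambda>t. integral {0..t} control"]) auto
qed

lemma measurable_position: "position \<in> borel_measurable lebesgue"
  using borel_measurable_continuous_onI[OF continuous_position] by (intro measurable_completion) simp

lemma integral_control:
  assumes "0 \<le> s" "s \<le> t" "t \<le> 1"
  shows "integral {s..t} control = position t - position s"
  using Henstock_Kurzweil_Integration.integral_combine[OF assms(1,2) control_integrable] assms
  by (simp add: position_def algebra_simps)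

lemma norm_position: "norm (position t) \<le> 1"
proof -
  have "norm (position t) \<le> integral {0..max 0 (min 1 t)} (\<lambda>_. 1)"
    unfolding position_def by (rule integral_norm_bound_integral) (auto simp: control_integrable)
  then show ?thesis by simp
qed

lemma measurable_velocity: "velocity \<in> borel_measurable lebesgue"
proof -
  note [measurable] = control_lebesgue measurable_position
  show ?thesis unfolding velocity_def X1_def X2_def vector_5 by measurable
qed

lemma norm_velocity: "norm (velocity t) \<le> 5"
proof -
  let ?a = "Re (position t)" and ?b = "Im (position t)"
  have c: "\<bar>Re (control t)\<bar> \<le> 1" "\<bar>Im (control t)\<bar> \<le> 1"
    using abs_Re_le_cmod[of "control t"] abs_Im_le_cmod[of "control t"] by simp_all
  have p: "\<bar>?a\<bar> \<le> 1" "\<bar>?b\<bar> \<le> 1"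
    using abs_Re_le_cmod[of "position t"] abs_Im_le_cmod[of "position t"] norm_position[of t] by linarith+
  have "norm (velocity t) \<le> \<bar>Re (control t)\<bar> * norm (coord_field 1) + \<bar>Im (control t)\<bar> *
      (norm (coord_field 2) + \<bar>?a\<bar> * norm (coord_field 3) + \<bar>1 / 2 * ?a\<^sup>2\<bar> * norm (coord_field 4)
        + \<bar>?a * ?b\<bar> * norm (coord_field 5))"
    unfolding velocity_def X1_def X2_def vector_5
    by (intro order_trans[OF norm_triangle_ineq] add_mono order_refl)
      (auto intro!: mult_left_mono norm_triangle_le norm_triangle_le_diff add_mono)
  also have "\<dots> \<le> 1 * 1 + 1 * (1 + 1 * 1 + 1 / 2 * 1 + 1 * 1)"
  proof -
    have "\<bar>1 / 2 * ?a\<^sup>2\<bar> \<le> 1 / 2" "\<bar>?a * ?b\<bar> \<le> 1"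
      using p mult_mono[OF p] by (simp_all add: abs_square_le_1 abs_mult)
    with c p show ?thesis by (intro add_mono mult_mono) auto
  qed
  finally show ?thesis by simp
qed

lemma velocity_integrable: "velocity absolutely_integrable_on {a..b}"
  using measurable_velocity norm_velocity
  by (intro integrable_on_bounded_measurable[where B = 5]) (auto intro: measurable_restrict_space1)

lemma curve_diff:
  assumes "0 \<le> s" "s \<le> t"
  shows "curve t - curve s = integral {s..t} velocity"
  using Henstock_Kurzweil_Integration.integral_combine[OF assms, of velocity] velocity_integrable
  by (simp add: curve_def absolutely_integrable_on_def algebra_simps)

lemma curve_lipschitz:
  assumes "0 \<le> s" "0 \<le> t"
  shows "dist (curve s) (curve t) \<le> 5 * \<bar>s - t\<bar>"
proof -
  have "norm (curve t - curve s) \<le> 5 * (t - s)" if "0 \<le> s" "s \<le> t" for s t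
  proof -
    have "norm (integral {s..t} velocity) \<le> integral {s..t} (\<lambda>_. 5)"
      using velocity_integrable norm_velocity
      by (intro integral_norm_bound_integral) (auto simp: absolutely_integrable_on_def)
    then show ?thesis using curve_diff[OF that] that by simp
  qed
  from this[of s t] this[of t s] assms show ?thesis
    by (cases "s \<le> t") (auto simp: dist_norm norm_minus_commute)
qed

lemma curve_nth:
  assumes "0 \<le> t" "t \<le> 1"
  shows "curve t $ 1 = Re (position t)" "curve t $ 2 = Im (position t)"
proof -
  have int: "velocity integrable_on {0..t}"
    using velocity_integrable by (simp add: absolutely_integrable_on_def)
  have "curve t $ i = integral {0..t} (\<lambda>s. velocity s $ i)" for i
    unfolding curve_def integral_component_eq_cart[OF int] ..
  moreover have "velocity s $ 1 = Re (control s)" "velocity s $ 2 = Im (control s)" for s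
    by (simp_all add: velocity_def X1_def X2_def axis_def)
  ultimately show "curve t $ 1 = Re (position t)" "curve t $ 2 = Im (position t)"
    using assms Re_integral[OF control_integrable] Im_integral[OF control_integrable]
    by (simp_all add: position_def)
qed

lemma velocity_eq:
  assumes "0 \<le> t" "t \<le> 1"
  shows "velocity t = Re (control t) *\<^sub>R X1 (curve t) + Im (control t) *\<^sub>R X2 (curve t)"
  using curve_nth[OF assms] by (simp add: velocity_def X1_def X2_def)

lemma curve_derivative:
  "AE t in lebesgue. t \<in> {0..1} \<longrightarrow> (curve has_vector_derivative
     Re (control t) *\<^sub>R X1 (curve t) + Im (control t) *\<^sub>R X2 (curve t)) (at t within {0..1})"
proof -
  have "curve = (\<lambda>t. integral {0..t} velocity)" by (rule ext) (rule curve_def)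
  then have "AE t in lebesgue. t \<in> {0..1} \<longrightarrow> (curve has_vector_derivative velocity t) (at t within {0..1})"
    using AE_vector_derivative_integral[OF measurable_velocity norm_velocity, of 0 1] by simp
  then show ?thesis by (rule eventually_mono) (simp add: velocity_eq)
qed

section \<open>Horizontality and length of the curve\<close>

lemma abs_continuous_curve_onI:
  assumes lip: "\<And>s t. s \<in> {a..b} \<Longrightarrow> t \<in> {a..b} \<Longrightarrow> dist (g s) (g t) \<le> L * \<bar>s - t\<bar>"
  shows "abs_continuous_curve_on a b g"
  unfolding abs_continuous_curve_on_def
proof (intro allI impI)
  fix \<epsilon> :: real assume "\<epsilon> > 0"
  show "\<exists>\<delta>>0. \<forall>P. finite P \<longrightarrow> (\<forall>(s, t)\<in>P. a \<le> s \<and> s \<le> t \<and> t \<le> b) \<longrightarrow>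
      disjoint_family_on (\<lambda>(s, t). {s<..<t}) P \<longrightarrow> (\<Sum>(s, t)\<in>P. t - s) < \<delta> \<longrightarrow>
      (\<Sum>(s, t)\<in>P. dist (g s) (g t)) < \<epsilon>"
  proof (intro exI[of _ "\<epsilon> / (\<bar>L\<bar> + 1)"] conjI allI impI)
    show "\<epsilon> / (\<bar>L\<bar> + 1) > 0" using \<open>\<epsilon> > 0\<close> by simp
    fix P :: "(real \<times> real) set"
    assume P: "\<forall>(s, t)\<in>P. a \<le> s \<and> s \<le> t \<and> t \<le> b" and small: "(\<Sum>(s, t)\<in>P. t - s) < \<epsilon> / (\<bar>L\<bar> + 1)"
    have "(\<Sum>(s, t)\<in>P. dist (g s) (g t)) \<le> (\<Sum>(s, t)\<in>P. (\<bar>L\<bar> + 1) * (t - s))"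
    proof (rule sum_mono, clarify)
      fix s t assume "(s, t) \<in> P"
      then have st: "a \<le> s" "s \<le> t" "t \<le> b" using P by auto
      then have "dist (g s) (g t) \<le> L * (t - s)" using lip[of s t] by simp
      also have "\<dots> \<le> (\<bar>L\<bar> + 1) * (t - s)" using st by (intro mult_right_mono) auto
      finally show "dist (g s) (g t) \<le> (\<bar>L\<bar> + 1) * (t - s)" .
    qed
    also have "\<dots> = (\<bar>L\<bar> + 1) * (\<Sum>(s, t)\<in>P. t - s)"
      by (simp add: sum_distrib_left case_prod_unfold)
    also have "\<dots> < (\<bar>L\<bar> + 1) * (\<epsilon> / (\<bar>L\<bar> + 1))"
      using small by (intro mult_strict_left_mono) auto
    also have "\<dots> = \<epsilon>" by simp
    finally show "(\<Sum>(s, t)\<in>P. dist (g s) (g t)) < \<epsilon>" .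
  qed
qed

lemma Re_control_integrable: "(\<lambda>t. Re (control t)) absolutely_integrable_on {a..b}"
  and Im_control_integrable: "(\<lambda>t. Im (control t)) absolutely_integrable_on {a..b}"
proof -
  note [measurable] = control_lebesgue
  show "(\<lambda>t. Re (control t)) absolutely_integrable_on {a..b}"
    using abs_Re_le_cmod[of "control _"]
    by (intro integrable_on_bounded_measurable[where B = 1] measurable_restrict_space1) auto
  show "(\<lambda>t. Im (control t)) absolutely_integrable_on {a..b}"
    using abs_Im_le_cmod[of "control _"]
    by (intro integrable_on_bounded_measurable[where B = 1] measurable_restrict_space1) auto
qed

lemma horizontal_curve:
  assumes "0 \<le> s" "s \<le> t" "t \<le> 1"
  shows "horizontal_with s t curve (\<lambda>r. Re (control r)) (\<lambda>r. Im (control r))"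
  unfolding horizontal_with_def
proof (intro conjI Re_control_integrable Im_control_integrable)
  show "abs_continuous_curve_on s t curve"
    using assms curve_lipschitz by (intro abs_continuous_curve_onI[where L = 5]) auto
  show "AE r in lebesgue. r \<in> {s..t} \<longrightarrow> (curve has_vector_derivative
      Re (control r) *\<^sub>R X1 (curve r) + Im (control r) *\<^sub>R X2 (curve r)) (at r within {s..t})"
    using curve_derivative
    by (rule eventually_mono) (use assms in \<open>auto intro: has_vector_derivative_within_subset\<close>)
qed

text \<open>In \<open>cc_dist\<close> the curves run from the first argument to the second, so the
  Lipschitz estimate for parameters in decreasing order needs the curve run backward.\<close>

lemma horizontal_with_reverse:
  assumes "horizontal_with a b g u1 u2"
  shows "horizontal_with (- b) (- a) (\<lambda>r. g (- r)) (\<lambda>r. - u1 (- r)) (\<lambda>r. - u2 (- r))"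
  unfolding horizontal_with_def
proof (intro conjI)
  have ac: "abs_continuous_curve_on a b g" and u: "u1 absolutely_integrable_on {a..b}" "u2 absolutely_integrable_on {a..b}"
    and der: "AE t in lebesgue. t \<in> {a..b} \<longrightarrow>
      (g has_vector_derivative u1 t *\<^sub>R X1 (g t) + u2 t *\<^sub>R X2 (g t)) (at t within {a..b})"
    using assms by (auto simp: horizontal_with_def)
  show "abs_continuous_curve_on (- b) (- a) (\<lambda>r. g (- r))"
    unfolding abs_continuous_curve_on_def
  proof (intro allI impI)
    fix \<epsilon> :: real assume "\<epsilon> > 0"
    from ac[unfolded abs_continuous_curve_on_def, rule_format, OF this]
    obtain \<delta> where \<delta>: "\<delta> > 0" "\<forall>P. finite P \<longrightarrow> (\<forall>(s, t)\<in>P. a \<le> s \<and> s \<le> t \<and> t \<le> b) \<longrightarrow>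
      disjoint_family_on (\<lambda>(s, t). {s<..<t}) P \<longrightarrow> (\<Sum>(s, t)\<in>P. t - s) < \<delta> \<longrightarrow>
      (\<Sum>(s, t)\<in>P. dist (g s) (g t)) < \<epsilon>" by (elim exE conjE)
    show "\<exists>\<delta>>0. \<forall>P. finite P \<longrightarrow> (\<forall>(s, t)\<in>P. - b \<le> s \<and> s \<le> t \<and> t \<le> - a) \<longrightarrow>
      disjoint_family_on (\<lambda>(s, t). {s<..<t}) P \<longrightarrow> (\<Sum>(s, t)\<in>P. t - s) < \<delta> \<longrightarrow>
      (\<Sum>(s, t)\<in>P. dist (g (- s)) (g (- t))) < \<epsilon>"
    proof (intro exI[of _ \<delta>] conjI allI impI \<delta>(1))
      fix P :: "(real \<times> real) set"
      assume P: "finite P" "\<forall>(s, t)\<in>P. - b \<le> s \<and> s \<le> t \<and> t \<le> - a"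
        "disjoint_family_on (\<lambda>(s, t). {s<..<t}) P" "(\<Sum>(s, t)\<in>P. t - s) < \<delta>"
      let ?f = "\<lambda>(s, t). (- t, - s) :: real \<times> real"
      have inj: "inj_on ?f P" by (auto simp: inj_on_def)
      have "(\<Sum>(s, t)\<in>?f ` P. dist (g s) (g t)) < \<epsilon>"
      proof (rule \<delta>(2)[THEN spec, THEN mp, THEN mp, THEN mp, THEN mp])
        show "disjoint_family_on (\<lambda>(s, t). {s<..<t}) (?f ` P)"
          unfolding disjoint_family_on_def
        proof (intro ballI impI)
          fix i j assume "i \<in> ?f ` P" "j \<in> ?f ` P" and ne: "i \<noteq> j"
          then obtain s t s' t' where st: "(s, t) \<in> P" "(s', t') \<in> P"
            and ij: "i = (- t, - s)" "j = (- t', - s')" by auto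
          have "{s<..<t} \<inter> {s'<..<t'} = {}"
            using disjoint_family_onD[OF P(3) st] ne ij by auto
          moreover have "- x \<in> {s<..<t} \<inter> {s'<..<t'}" if "x \<in> {- t<..<- s} \<inter> {- t'<..<- s'}" for x
            using that by auto
          ultimately have "{- t<..<- s} \<inter> {- t'<..<- s'} = {}" by blast
          then show "(\<lambda>(s, t). {s<..<t}) i \<inter> (\<lambda>(s, t). {s<..<t}) j = {}" unfolding ij by simp
        qed
        show "(\<Sum>(s, t)\<in>?f ` P. t - s) < \<delta>"
          using P(4) by (subst sum.reindex[OF inj]) (simp add: case_prod_unfold)
      qed (use P(1,2) in auto)
      then show "(\<Sum>(s, t)\<in>P. dist (g (- s)) (g (- t))) < \<epsilon>"
        by (subst (asm) sum.reindex[OF inj]) (simp add: case_prod_unfold dist_commute)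
    qed
  qed
  show "(\<lambda>r. - u1 (- r)) absolutely_integrable_on {- b..- a}"
    "(\<lambda>r. - u2 (- r)) absolutely_integrable_on {- b..- a}"
    using absolutely_integrable_scaleR_left[where f = "\<lambda>r. u1 (- r)" and S = "{- b..- a}" and c = "- 1"]
      absolutely_integrable_scaleR_left[where f = "\<lambda>r. u2 (- r)" and S = "{- b..- a}" and c = "- 1"] u by simp_all
  show "AE t in lebesgue. t \<in> {- b..- a} \<longrightarrow> ((\<lambda>r. g (- r)) has_vector_derivative
      - u1 (- t) *\<^sub>R X1 (g (- t)) + - u2 (- t) *\<^sub>R X2 (g (- t))) (at t within {- b..- a})"
    unfolding AE_lebesgue_iff_negligible
  proof (rule negligible_subset)
    \<comment> \<open>Reflection is differentiable and so maps the negligible exceptional set of g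
      to a negligible set.\<close>
    let ?N = "{t. \<not> (t \<in> {a..b} \<longrightarrow> (g has_vector_derivative u1 t *\<^sub>R X1 (g t) + u2 t *\<^sub>R X2 (g t)) (at t within {a..b}))}"
    show "negligible (uminus ` ?N)"
      using der unfolding AE_lebesgue_iff_negligible
      by (intro negligible_differentiable_image_negligible) (auto intro!: derivative_intros)
    show "{t. \<not> (t \<in> {- b..- a} \<longrightarrow> ((\<lambda>r. g (- r)) has_vector_derivative
      - u1 (- t) *\<^sub>R X1 (g (- t)) + - u2 (- t) *\<^sub>R X2 (g (- t))) (at t within {- b..- a}))} \<subseteq> uminus ` ?N"
    proof (rule subsetI, rule ccontr)
      fix t assume t: "t \<in> {t. \<not> (t \<in> {- b..- a} \<longrightarrow> ((\<lambda>r. g (- r)) has_vector_derivative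
        - u1 (- t) *\<^sub>R X1 (g (- t)) + - u2 (- t) *\<^sub>R X2 (g (- t))) (at t within {- b..- a}))}"
        "t \<notin> uminus ` ?N"
      have "- t \<notin> ?N" using t(2) image_eqI[of t uminus "- t" ?N] by auto
      moreover have "- t \<in> {a..b}" using t(1) by auto
      ultimately have "(g has_vector_derivative u1 (- t) *\<^sub>R X1 (g (- t)) + u2 (- t) *\<^sub>R X2 (g (- t)))
          (at (- t) within uminus ` {- b..- a})" by simp
      then have "((g \<circ> uminus) has_vector_derivative
          (- 1) *\<^sub>R (u1 (- t) *\<^sub>R X1 (g (- t)) + u2 (- t) *\<^sub>R X2 (g (- t)))) (at t within {- b..- a})"
        by (intro vector_diff_chain_within) (auto intro!: derivative_eq_intros)
      then show False using t(1) by (simp add: o_def algebra_simps)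
    qed
  qed
qed

lemma cc_dist_le:
  assumes "a \<le> b" "horizontal_with a b g u1 u2"
  shows "cc_dist (g a) (g b) \<le> ennreal (control_length a b u1 u2)"
  unfolding cc_dist_def using assms by (intro Inf_lower) blast

lemma control_length_control:
  assumes "s \<le> t"
  shows "control_length s t (\<lambda>r. Re (control r)) (\<lambda>r. Im (control r)) = t - s"
    and "control_length (- t) (- s) (\<lambda>r. - Re (control (- r))) (\<lambda>r. - Im (control (- r))) = t - s"
  using assms by (simp_all add: control_length_def cmod_def[symmetric])

text \<open>The control has modulus 1, so the arc between two parameters has length equal to their
  distance, and 1 is a Lipschitz constant.\<close>

theorem cc_lipschitz_curve: "cc_lipschitz curve"
  unfolding cc_lipschitz_def
proof (intro exI[of _ 1] conjI ballI)
  fix s t :: real assume st: "s \<in> {0..1}" "t \<in> {0..1}"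
  show "cc_dist (curve s) (curve t) \<le> ennreal (1 * \<bar>s - t\<bar>)"
  proof (cases "s \<le> t")
    case True
    then show ?thesis
      using cc_dist_le[OF True horizontal_curve] st control_length_control(1)[OF True] by simp
  next
    case False
    then have ts: "t \<le> s" by simp
    have "horizontal_with t s curve (\<lambda>r. Re (control r)) (\<lambda>r. Im (control r))"
      using st ts by (intro horizontal_curve) auto
    from cc_dist_le[OF _ horizontal_with_reverse[OF this]] show ?thesis
      using ts control_length_control(2)[OF ts] by simp
  qed
qed simp

section \<open>Comparison with continuously differentiable horizontal curves\<close>

text \<open>The coefficients come from writing \<open>(x\<^sub>2 - p\<^sub>2)\<^sup>2 dx\<^sub>1\<close> and \<open>(x\<^sub>1 - p\<^sub>1)\<^sup>2 dx\<^sub>2\<close> as exact forms on horizontal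
  curves, where \<open>dx\<^sub>3 = - x\<^sub>1 dx\<^sub>2\<close>, \<open>dx\<^sub>4 = x\<^sub>1\<^sup>2 dx\<^sub>2 / 2\<close> and \<open>dx\<^sub>5 = x\<^sub>1 x\<^sub>2 dx\<^sub>2\<close>.\<close>
definition calib :: "complex \<Rightarrow> real ^ 5 \<Rightarrow> real ^ 5 \<Rightarrow> real"
  where "calib d p x = Re d * ((x $ 2 - p $ 2)\<^sup>2 * x $ 1 - 2 * x $ 5 - 2 * p $ 2 * x $ 3)
    + Im d * (2 * x $ 4 + 2 * p $ 1 * x $ 3 + (p $ 1)\<^sup>2 * x $ 2)"

abbreviation planar :: "real ^ 5 \<Rightarrow> complex"
  where "planar x \<equiv> Complex (x $ 1) (x $ 2)"

lemma has_derivative_nth: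
  fixes g :: "real \<Rightarrow> real ^ 'n"
  assumes "(g has_vector_derivative g') F"
  shows "((\<lambda>t. g t $ i) has_vector_derivative g' $ i) F"
  using bounded_linear.has_vector_derivative[OF bounded_linear_vec_nth assms] .

text \<open>The derivative is \<open>Re d\<close> times the first of the two forms plus
  \<open>Im d\<close> times the second. One of \<open>Re d\<close> and \<open>Im d\<close> vanishes
  and the other is 1 or - 1, so what remains is the squared offset transverse to d times the speed
  along d.\<close>

lemma calib_derivative:
  assumes d: "d \<in> {1, \<i>, - 1, - \<i>}"
    and g: "(g has_vector_derivative Re u *\<^sub>R X1 (g t) + Im u *\<^sub>R X2 (g t)) (at t within S)"
  shows "((\<lambda>t. calib d p (g t)) has_real_derivative
    (Im (cnj d * (planar (g t) - planar p)))\<^sup>2 * Re (cnj d * u)) (at t within S)"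
proof -
  note D = has_derivative_nth[OF g, folded has_real_derivative_iff_has_vector_derivative]
  have D1: "((\<lambda>t. g t $ 1) has_real_derivative Re u) (at t within S)"
    using D[of 1] by (simp add: X1_def X2_def axis_def)
  have D2: "((\<lambda>t. g t $ 2) has_real_derivative Im u) (at t within S)"
    using D[of 2] by (simp add: X1_def X2_def axis_def)
  have D3: "((\<lambda>t. g t $ 3) has_real_derivative - (g t $ 1) * Im u) (at t within S)"
    using D[of 3] by (simp add: X1_def X2_def axis_def mult.commute)
  have D4: "((\<lambda>t. g t $ 4) has_real_derivative 1 / 2 * (g t $ 1)\<^sup>2 * Im u) (at t within S)"
    using D[of 4] by (simp add: X1_def X2_def axis_def mult.commute)
  have D5: "((\<lambda>t. g t $ 5) has_real_derivative g t $ 1 * g t $ 2 * Im u) (at t within S)"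
    using D[of 5] by (simp add: X1_def X2_def axis_def mult.commute)
  have "((\<lambda>t. calib d p (g t)) has_real_derivative
      Re d * ((g t $ 2 - p $ 2)\<^sup>2 * Re u) + Im d * ((g t $ 1 - p $ 1)\<^sup>2 * Im u)) (at t within S)"
    unfolding calib_def
    by (rule derivative_eq_intros D1 D2 D3 D4 D5 refl)+ (simp add: algebra_simps power2_eq_square)
  also have "Re d * ((g t $ 2 - p $ 2)\<^sup>2 * Re u) + Im d * ((g t $ 1 - p $ 1)\<^sup>2 * Im u)
      = (Im (cnj d * (planar (g t) - planar p)))\<^sup>2 * Re (cnj d * u)"
    using d by (auto simp: power2_eq_square algebra_simps)
  finally show ?thesis .
qed

lemma lipschitz_on_mult_compact:
  fixes f g :: "real \<Rightarrow> real"
  assumes "compact S" "\<exists>L. L-lipschitz_on S f" "\<exists>L. L-lipschitz_on S g"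
  shows "\<exists>L. L-lipschitz_on S (\<lambda>x. f x * g x)"
proof -
  obtain L M where L: "L-lipschitz_on S f" and M: "M-lipschitz_on S g" using assms by blast
  have "bounded (f ` S)" "bounded (g ` S)"
    using L M assms(1)
    by (auto intro!: compact_imp_bounded compact_continuous_image dest: lipschitz_on_continuous_on)
  then obtain A B where A: "\<And>x. x \<in> S \<Longrightarrow> \<bar>f x\<bar> \<le> A" and B: "\<And>x. x \<in> S \<Longrightarrow> \<bar>g x\<bar> \<le> B"
    by (auto simp: bounded_iff)
  have "(\<bar>A\<bar> * M + L * \<bar>B\<bar>)-lipschitz_on S (\<lambda>x. f x * g x)"
  proof (rule lipschitz_onI)
    show "0 \<le> \<bar>A\<bar> * M + L * \<bar>B\<bar>"
      using lipschitz_on_nonneg[OF L] lipschitz_on_nonneg[OF M] by simp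
    fix x y assume xy: "x \<in> S" "y \<in> S"
    have "f x * g x - f y * g y = f x * (g x - g y) + (f x - f y) * g y" by (simp add: algebra_simps)
    then have "dist (f x * g x) (f y * g y) \<le> \<bar>f x\<bar> * \<bar>g x - g y\<bar> + \<bar>f x - f y\<bar> * \<bar>g y\<bar>"
      by (metis abs_mult abs_triangle_ineq dist_real_def)
    also have "\<dots> \<le> \<bar>A\<bar> * (M * dist x y) + (L * dist x y) * \<bar>B\<bar>"
      using A[OF xy(1)] B[OF xy(2)] lipschitz_onD[OF L xy] lipschitz_onD[OF M xy]
        lipschitz_on_nonneg[OF L] lipschitz_on_nonneg[OF M]
      by (intro add_mono mult_mono) (auto simp: dist_real_def)
    finally show "dist (f x * g x) (f y * g y) \<le> (\<bar>A\<bar> * M + L * \<bar>B\<bar>) * dist x y"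
      by (simp add: algebra_simps)
  qed
  then show ?thesis by blast
qed

text \<open>Supplies the Lipschitz hypothesis of \<open>lipschitz_AE_derivative_zero\<close>. The
  function \<open>calib d p\<close> is a polynomial in the coordinates, and on a compact set sums
  and products of Lipschitz functions are Lipschitz.\<close>

lemma calib_lipschitz:
  fixes g :: "real \<Rightarrow> real ^ 5"
  assumes S: "compact S" and g: "L-lipschitz_on S g"
  shows "\<exists>M. M-lipschitz_on S (\<lambda>t. calib d p (g t))"
proof -
  have nth: "\<exists>M. M-lipschitz_on S (\<lambda>t. g t $ i)" for i
  proof -
    have "L-lipschitz_on S (\<lambda>t. g t $ i)"
    proof (rule lipschitz_onI)
      fix x y assume "x \<in> S" "y \<in> S"
      have "dist (g x $ i) (g y $ i) \<le> dist (g x) (g y)" by (rule dist_vec_nth_le)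
      also have "\<dots> \<le> L * dist x y" using \<open>x \<in> S\<close> \<open>y \<in> S\<close> by (rule lipschitz_onD[OF g])
      finally show "dist (g x $ i) (g y $ i) \<le> L * dist x y" .
    qed (rule lipschitz_on_nonneg[OF g])
    then show ?thesis by blast
  qed
  have const: "\<exists>M. M-lipschitz_on S (\<lambda>t. c)" for c :: real by (blast intro: lipschitz_on_constant)
  have add: "\<exists>M. M-lipschitz_on S (\<lambda>t. f t + h t)"
    if "\<exists>M. M-lipschitz_on S f" "\<exists>M. M-lipschitz_on S h" for f h :: "real \<Rightarrow> real"
    using that by (blast intro: lipschitz_on_add)
  have diff: "\<exists>M. M-lipschitz_on S (\<lambda>t. f t - h t)"
    if "\<exists>M. M-lipschitz_on S f" "\<exists>M. M-lipschitz_on S h" for f h :: "real \<Rightarrow> real"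
    using that by (blast intro: lipschitz_on_diff)
  show ?thesis
    unfolding calib_def power2_eq_square
    by (intro add diff lipschitz_on_mult_compact[OF S] const nth)
qed

text \<open>The differential equation of the curve is known only almost everywhere. The calibration
  minus the integral of its almost everywhere derivative is Lipschitz with derivative 0 almost
  everywhere, hence constant.\<close>

lemma calib_curve_diff:
  assumes st: "0 \<le> s" "s \<le> t" "t \<le> 1" and d: "d \<in> {1, \<i>, - 1, - \<i>}"
  shows "calib d (curve s) (curve t) - calib d (curve s) (curve s)
    = integral {s..t} (\<lambda>r. (Im (cnj d * integral {s..r} control))\<^sup>2 * Re (cnj d * control r))"
proof -
  define \<phi> where "\<phi> = (\<lambda>r. (Im (cnj d * (position r - position s)))\<^sup>2 * Re (cnj d * control r))"
  define F where "F = (\<lambda>r. calib d (curve s) (curve r) - integral {s..r} \<phi>)"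
  have nd: "norm d = 1" using d by auto
  note [measurable] = control_lebesgue measurable_position
  have \<phi>m: "\<phi> \<in> borel_measurable lebesgue" unfolding \<phi>_def by measurable
  have \<phi>b: "norm (\<phi> r) \<le> 4" for r
  proof -
    have "\<bar>Im (cnj d * (position r - position s))\<bar> \<le> norm (position r - position s)"
      using abs_Im_le_cmod[of "cnj d * (position r - position s)"] nd by (simp add: norm_mult)
    also have "\<dots> \<le> 2" using norm_triangle_ineq4[of "position r" "position s"] norm_position[of r] norm_position[of s] by linarith
    finally have "(Im (cnj d * (position r - position s)))\<^sup>2 \<le> 2\<^sup>2" using power_mono[OF _ abs_ge_zero, of _ 2 2] by fastforce
    moreover have "\<bar>Re (cnj d * control r)\<bar> \<le> 1"
      using abs_Re_le_cmod[of "cnj d * control r"] nd by (simp add: norm_mult)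
    ultimately have "(Im (cnj d * (position r - position s)))\<^sup>2 * \<bar>Re (cnj d * control r)\<bar> \<le> 2\<^sup>2 * 1"
      by (intro mult_mono) auto
    then show ?thesis by (simp add: \<phi>_def abs_mult)
  qed
  have \<phi>i: "\<phi> integrable_on {a..b}" for a b
    using integrable_on_bounded_measurable[of \<phi> a b 4] \<phi>m \<phi>b
    by (auto simp: measurable_restrict_space1 absolutely_integrable_on_def)
  have pl: "planar (curve r) = position r" if "0 \<le> r" "r \<le> 1" for r
    using curve_nth[OF that] by (simp add: complex_eq_iff)
  have "F t = F s"
  proof -
    have "5-lipschitz_on {s..t} curve"
      using st curve_lipschitz by (intro lipschitz_onI) (auto simp: dist_real_def)
    then obtain M where M: "M-lipschitz_on {s..t} (\<lambda>r. calib d (curve s) (curve r))"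
      using calib_lipschitz[of "{s..t}" 5 curve] by auto
    have I: "\<bar>integral {s..x} \<phi> - integral {s..y} \<phi>\<bar> \<le> 4 * \<bar>x - y\<bar>" if "x \<in> {s..t}" "y \<in> {s..t}" for x y
    proof -
      have *: "\<bar>integral {s..y} \<phi> - integral {s..x} \<phi>\<bar> \<le> 4 * (y - x)" if "s \<le> x" "x \<le> y" for x y
      proof -
        have "integral {s..y} \<phi> - integral {s..x} \<phi> = integral {x..y} \<phi>"
          using Henstock_Kurzweil_Integration.integral_combine[OF that \<phi>i] by linarith
        moreover have "norm (integral {x..y} \<phi>) \<le> integral {x..y} (\<lambda>_. 4)"
          by (rule integral_norm_bound_integral) (use \<phi>i \<phi>b in auto)
        ultimately show ?thesis using that by simp
      qed
      show ?thesis
        using *[of x y] *[of y x] that by (cases "x \<le> y") auto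
    qed
    have AEd: "AE r in lebesgue. r \<in> {s..t} \<longrightarrow> (F has_vector_derivative 0) (at r within {s..t})"
      using curve_derivative AE_vector_derivative_integral[OF \<phi>m \<phi>b, of s t]
    proof eventually_elim
      case (elim r)
      show ?case
      proof
        assume r: "r \<in> {s..t}"
        then have r1: "0 \<le> r" "r \<le> 1" "0 \<le> s" "s \<le> 1" using st by auto
        have "(curve has_vector_derivative Re (control r) *\<^sub>R X1 (curve r) + Im (control r) *\<^sub>R X2 (curve r)) (at r within {s..t})"
          using elim(1) r1 st by (auto intro: has_vector_derivative_within_subset)
        from calib_derivative[OF d this, of "curve s"]
        have "((\<lambda>r. calib d (curve s) (curve r)) has_vector_derivative \<phi> r) (at r within {s..t})"
          unfolding pl[OF r1(1,2)] pl[OF r1(3,4)] \<phi>_def has_real_derivative_iff_has_vector_derivative .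
        then have "(F has_vector_derivative \<phi> r - \<phi> r) (at r within {s..t})"
          unfolding F_def using elim(2) r by (intro has_vector_derivative_diff) auto
        then show "(F has_vector_derivative 0) (at r within {s..t})" by simp
      qed
    qed
    show ?thesis
    proof (rule lipschitz_AE_derivative_zero[OF st(2) _ AEd])
      fix x y assume xy: "x \<in> {s..t}" "y \<in> {s..t}"
      have "norm (F x - F y) \<le> \<bar>calib d (curve s) (curve x) - calib d (curve s) (curve y)\<bar>
          + \<bar>integral {s..x} \<phi> - integral {s..y} \<phi>\<bar>"
        by (simp add: F_def)
      also have "\<dots> \<le> M * \<bar>x - y\<bar> + 4 * \<bar>x - y\<bar>"
        using lipschitz_onD[OF M xy] I[OF xy] by (intro add_mono) (simp_all add: dist_real_def)
      finally show "norm (F x - F y) \<le> (M + 4) * \<bar>x - y\<bar>" by (simp add: algebra_simps)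
    qed
  qed
  then have "calib d (curve s) (curve t) - calib d (curve s) (curve s) = integral {s..t} \<phi>"
    by (simp add: F_def)
  also have "\<dots> = integral {s..t} (\<lambda>r. (Im (cnj d * integral {s..r} control))\<^sup>2 * Re (cnj d * control r))"
    using st integral_control unfolding \<phi>_def
    by (intro Henstock_Kurzweil_Integration.integral_cong) auto
  finally show ?thesis .
qed

text \<open>The set of interior points where \<open>\<phi>\<close> differs from 0 is open, and a
  nonempty open set is not negligible.\<close>

lemma continuous_AE_zero:
  fixes \<phi> :: "real \<Rightarrow> 'a::real_normed_vector"
  assumes "continuous_on {a..b} \<phi>" "AE t in lebesgue. t \<in> {a..b} \<longrightarrow> \<phi> t = 0" "t \<in> {a<..<b}"
  shows "\<phi> t = 0"
proof (rule ccontr)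
  assume nz: "\<phi> t \<noteq> 0"
  let ?U = "{a<..<b} \<inter> \<phi> -` (- {0})"
  have "open ?U"
    by (rule continuous_open_preimage) (auto intro: continuous_on_subset[OF assms(1)])
  moreover have "t \<in> ?U" using nz assms(3) by simp
  moreover have "negligible ?U"
    using assms(2) unfolding AE_lebesgue_iff_negligible by (rule negligible_subset) auto
  ultimately show False using open_not_negligible by blast
qed

text \<open>The horizontality equation extends from almost every point to every interior point
  because both of its sides can be written continuously.\<close>

lemma C1H_curve_derivative:
  assumes "C1H_curve \<Gamma>"
  shows "\<exists>U. continuous_on {0..1} U \<and> continuous_on {0..1} \<Gamma> \<and> (\<forall>t\<in>{0<..<1}.
    (\<Gamma> has_vector_derivative Re (U t) *\<^sub>R X1 (\<Gamma> t) + Im (U t) *\<^sub>R X2 (\<Gamma> t)) (at t))"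
proof -
  obtain u1 u2 where AEd: "AE t in lebesgue. t \<in> {0..1} \<longrightarrow>
      (\<Gamma> has_vector_derivative u1 t *\<^sub>R X1 (\<Gamma> t) + u2 t *\<^sub>R X2 (\<Gamma> t)) (at t within {0..1})"
    using assms unfolding C1H_curve_def horizontal_def horizontal_with_def by blast
  obtain g' where g': "continuous_on {0..1} g'"
    "\<And>t. t \<in> {0..1} \<Longrightarrow> (\<Gamma> has_vector_derivative g' t) (at t within {0..1})"
    using assms unfolding C1H_curve_def C1_curve_on_def by blast
  have \<Gamma>c: "continuous_on {0..1} \<Gamma>"
    unfolding continuous_on_eq_continuous_within using has_vector_derivative_continuous[OF g'(2)] by blast
  \<comment> \<open>The first two components of X1 and X2 are (1, 0) and (0, 1), so those of the
    derivative are the controls wherever the horizontality equation holds. Replacing the controls by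
    them makes the expression continuous.\<close>
  define \<phi> where "\<phi> = (\<lambda>t. g' t - (g' t $ 1 *\<^sub>R X1 (\<Gamma> t) + g' t $ 2 *\<^sub>R X2 (\<Gamma> t)))"
  have "\<phi> t = 0" if "t \<in> {0<..<1}" for t
  proof (rule continuous_AE_zero[OF _ _ that])
    show "continuous_on {0..1} \<phi>"
      unfolding \<phi>_def X1_def X2_def by (intro continuous_intros g'(1) \<Gamma>c)
    show "AE t in lebesgue. t \<in> {0..1} \<longrightarrow> \<phi> t = 0"
      using AEd
    proof eventually_elim
      case (elim t)
      show ?case
      proof
        assume t: "t \<in> {0..1}"
        have eq: "g' t = u1 t *\<^sub>R X1 (\<Gamma> t) + u2 t *\<^sub>R X2 (\<Gamma> t)"
          using vector_derivative_unique_within_closed_interval[of 0 1 t \<Gamma>] g'(2)[OF t] elim t by auto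
        then have "g' t $ 1 = u1 t" "g' t $ 2 = u2 t" by (simp_all add: X1_def X2_def axis_def)
        then show "\<phi> t = 0" using eq by (simp add: \<phi>_def)
      qed
    qed
  qed
  then have eq: "g' t = g' t $ 1 *\<^sub>R X1 (\<Gamma> t) + g' t $ 2 *\<^sub>R X2 (\<Gamma> t)" if "t \<in> {0<..<1}" for t
    using that by (simp add: \<phi>_def)
  show ?thesis
  proof (intro exI[of _ "\<lambda>t. planar (g' t)"] conjI ballI)
    show "continuous_on {0..1} (\<lambda>t. planar (g' t))"
      unfolding Complex_eq by (intro continuous_intros g'(1))
    fix t :: real assume t: "t \<in> {0<..<1}"
    have "(\<Gamma> has_vector_derivative g' t) (at t)"
      using g'(2)[of t] t at_within_interior[of t "{0..1}"] by simp
    then show "(\<Gamma> has_vector_derivative Re (planar (g' t)) *\<^sub>R X1 (\<Gamma> t) + Im (planar (g' t)) *\<^sub>R X2 (\<Gamma> t)) (at t)"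
      using eq[OF t] by simp
  qed (rule \<Gamma>c)
qed

text \<open>If K missed the first or the last quarter of the cell, its part in the cell would fit
  into an interval of length \<open>3 / 4 / N\<close>.\<close>

lemma exists_far_points:
  fixes K :: "real set"
  assumes K: "K \<in> lmeasurable" and N: "N > 0"
    and dense: "measure lebesgue (K \<inter> {a..<a + 1 / N}) > 3 / 4 / N"
  obtains s t where "s \<in> K" "a \<le> s" "s \<le> a + 1 / 4 / N" "t \<in> K" "a + 3 / 4 / N \<le> t" "t < a + 1 / N"
proof -
  have thin: "measure lebesgue (K \<inter> {a..<a + 1 / N}) \<le> 3 / 4 / N"
    if "K \<inter> {a..<a + 1 / N} \<subseteq> {c..c + 3 / 4 / N}" for c
  proof -
    have "measure lebesgue (K \<inter> {a..<a + 1 / N}) \<le> measure lebesgue {c..c + 3 / 4 / N}"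
      using K by (intro measure_mono_fmeasurable[OF that]) (auto dest: fmeasurableD)
    then show ?thesis using N by simp
  qed
  have 4: "1 / N = 4 * (1 / 4 / N)" "3 / 4 / N = 3 * (1 / 4 / N)" by simp_all
  have "\<exists>s. s \<in> K \<and> a \<le> s \<and> s \<le> a + 1 / 4 / N"
  proof (rule ccontr)
    assume "\<not> ?thesis"
    then have "K \<inter> {a..<a + 1 / N} \<subseteq> {a + 1 / 4 / N..(a + 1 / 4 / N) + 3 / 4 / N}"
      using 4 by fastforce
    then show False using thin dense by fastforce
  qed
  moreover have "\<exists>t. t \<in> K \<and> a + 3 / 4 / N \<le> t \<and> t < a + 1 / N"
  proof (rule ccontr)
    assume "\<not> ?thesis"
    then have "K \<inter> {a..<a + 1 / N} \<subseteq> {a..a + 3 / 4 / N}" by fastforce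
    then show False using thin dense by fastforce
  qed
  ultimately show thesis using that by blast
qed

section \<open>The coincidence set is null\<close>

theorem theorem1p2:
  shows "\<exists>\<gamma> :: real \<Rightarrow> real ^ 5. cc_lipschitz \<gamma> \<and>
    (\<forall>\<Gamma> :: real \<Rightarrow> real ^ 5. C1H_curve \<Gamma> \<longrightarrow>
      {t \<in> {0..1}. \<Gamma> t = \<gamma> t} \<in> null_sets lebesgue)"
proof (intro exI[of _ curve] conjI allI impI cc_lipschitz_curve)
  fix \<Gamma> :: "real \<Rightarrow> real ^ 5" assume "C1H_curve \<Gamma>"
  then obtain U where U: "continuous_on {0..1} U" and \<Gamma>: "continuous_on {0..1} \<Gamma>"
    and der: "\<And>t. t \<in> {0<..<1} \<Longrightarrow>
      (\<Gamma> has_vector_derivative Re (U t) *\<^sub>R X1 (\<Gamma> t) + Im (U t) *\<^sub>R X2 (\<Gamma> t)) (at t)"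
    using C1H_curve_derivative by blast
  define K where "K = {t \<in> {0..1}. \<Gamma> t = curve t}"
  have "continuous_on {0..1} curve"
    using curve_lipschitz by (intro lipschitz_on_continuous_on[of 5] lipschitz_onI) (auto simp: dist_real_def)
  then have "closed ({0..1} \<inter> (\<lambda>t. \<Gamma> t - curve t) -` {0})"
    by (intro continuous_closed_preimage continuous_on_diff \<Gamma>) auto
  also have "{0..1} \<inter> (\<lambda>t. \<Gamma> t - curve t) -` {0} = K" by (auto simp: K_def)
  finally have "closed K" .
  then have Kc: "compact K" by (auto simp: K_def compact_eq_bounded_closed intro: bounded_subset[of "{0..1}"])
  have Km: "K \<in> lmeasurable" using Kc by (rule lmeasurable_compact)
  have "measure lebesgue K = 0"
  proof (rule ccontr)
    assume "measure lebesgue K \<noteq> 0"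
    then have Kpos: "measure lebesgue K > 0" by (simp add: zero_less_measure_iff)
    have "uniformly_continuous_on {0..1} U"
      using U by (rule compact_uniformly_continuous) simp
    \<comment> \<open>The tolerance 1 / 2 is the gap that will appear between a forward speed of at
      least 1 / 2 and a negative one.\<close>
    then obtain \<delta> where \<delta>: "\<delta> > 0" "\<And>x y. x \<in> {0..1} \<Longrightarrow> y \<in> {0..1} \<Longrightarrow> dist y x < \<delta> \<Longrightarrow> dist (U y) (U x) < 1 / 2"
      unfolding uniformly_continuous_on_def by (meson half_gt_zero zero_less_one)
    have "K \<subseteq> {0..1}" by (auto simp: K_def)
    \<comment> \<open>The fraction 3 / 4 is what \<open>exists_far_points\<close> requires.\<close>
    note dense_cell[OF Kc this Kpos, of "3 / 4"]
    moreover have "\<forall>\<^sub>F N in sequentially. 1 / real N < \<delta>"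
      by (rule order_tendstoD(2)[OF lim_1_over_n \<delta>(1)])
    ultimately have "\<forall>\<^sub>F N in sequentially. 1 / real N < \<delta> \<and>
        (\<exists>i<N. measure lebesgue (K \<inter> {real i / real N..<(real i + 1) / real N}) > 3 / 4 / real N)"
      by (auto intro: eventually_conj)
    \<comment> \<open>What holds for all large N holds for the grid sizes of all high levels, since
      they tend to infinity.\<close>
    from eventually_happens'[OF sequentially_bot eventually_compose_filterlim[OF this filterlim_grid]]
    obtain n i where n: "1 / real (grid n) < \<delta>" and i: "i < grid n"
      and dense: "measure lebesgue (K \<inter> {real i / real (grid n)..<(real i + 1) / real (grid n)}) > 3 / 4 / real (grid n)"
      by blast
    define N a where "N = real (grid n)" and "a = real i / N"
    have N: "N > 0" using grid_pos by (simp add: N_def)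
    obtain s t where s: "s \<in> K" "a \<le> s" "s \<le> a + 1 / 4 / N" and t: "t \<in> K" "a + 3 / 4 / N \<le> t" "t < a + 1 / N"
      using exists_far_points[OF Km N, of a] dense by (auto simp: N_def a_def add_divide_distrib)
    obtain d where d: "d \<in> {1, \<i>, - 1, - \<i>}"
      and neg: "integral {s..t} (\<lambda>r. (Im (cnj d * integral {s..r} control))\<^sup>2 * Re (cnj d * control r)) < 0"
      and fwd: "(t - s) / 2 \<le> Re (cnj d * integral {s..t} control)"
    proof -
      have "real i / grid n \<le> s" "s \<le> (real i + 1 / 4) / grid n"
        "(real i + 3 / 4) / grid n \<le> t" "t < (real i + 1) / grid n"
        using s(2,3) t(2,3) by (simp_all add: N_def a_def add_divide_distrib)
      from control_on_cell[OF i this] show thesis using that by blast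
    qed
    have "1 / N = 4 * (1 / 4 / N)" "3 / 4 / N = 3 * (1 / 4 / N)" "1 / 4 / N > 0" using N by simp_all
    then have st: "s < t" "t - s < \<delta>" using s t n unfolding N_def[symmetric] by linarith+
    have st01: "0 \<le> s" "t \<le> 1" "0 \<le> t" "s \<le> 1" using s(1) t(1) by (auto simp: K_def)
    have nd: "norm (cnj d) = 1" using d by auto
    have \<Gamma>st: "continuous_on {s..t} \<Gamma>" using st01 by (intro continuous_on_subset[OF \<Gamma>]) auto
    have eqs: "\<Gamma> s = curve s" "\<Gamma> t = curve t" using s(1) t(1) by (auto simp: K_def)
    have "\<exists>\<xi>. s < \<xi> \<and> \<xi> < t \<and> Re (cnj d * U \<xi>) < 0"
    proof -
      let ?f = "\<lambda>r. calib d (\<Gamma> s) (\<Gamma> r)"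
      let ?f' = "\<lambda>r. (Im (cnj d * (planar (\<Gamma> r) - planar (\<Gamma> s))))\<^sup>2 * Re (cnj d * U r)"
      have "continuous_on {s..t} ?f"
        unfolding calib_def by (intro continuous_intros \<Gamma>st)
      moreover have "(?f has_real_derivative ?f' r) (at r)" if "s < r" "r < t" for r
        using calib_derivative[OF d der[of r]] that st01 by simp
      ultimately obtain \<xi> where \<xi>: "s < \<xi>" "\<xi> < t" "?f t - ?f s = ?f' \<xi> * (t - s)"
        using mvt_field[OF st(1), of ?f ?f'] by blast
      \<comment> \<open>This increment involves only the values at s and t, where both curves agree,
        so its sign can be computed along \<open>curve\<close>.\<close>
      have "?f t - ?f s < 0"
        unfolding eqs calib_curve_diff[OF st01(1) less_imp_le[OF st(1)] st01(2) d] by (rule neg)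
      then have "Re (cnj d * U \<xi>) < 0"
        unfolding \<xi>(3) using st(1) zero_le_power2 by (smt (verit) mult_nonneg_nonneg)
      then show ?thesis using \<xi> by blast
    qed
    then obtain \<xi> where \<xi>: "s < \<xi>" "\<xi> < t" "Re (cnj d * U \<xi>) < 0" by blast
    have "\<exists>\<eta>. s < \<eta> \<and> \<eta> < t \<and> Re (cnj d * U \<eta>) \<ge> 1 / 2"
    proof -
      let ?f = "\<lambda>r. Re d * \<Gamma> r $ 1 + Im d * \<Gamma> r $ 2"
      have "continuous_on {s..t} ?f" by (intro continuous_intros \<Gamma>st)
      moreover have "(?f has_real_derivative Re (cnj d * U r)) (at r)" if "s < r" "r < t" for r
      proof -
        have r: "r \<in> {0<..<1}" using that st01 by simp
        note D = has_derivative_nth[OF der[OF r], folded has_real_derivative_iff_has_vector_derivative]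
        have "((\<lambda>r. \<Gamma> r $ 1) has_real_derivative Re (U r)) (at r)"
          using D[of 1] by (simp add: X1_def X2_def axis_def)
        moreover have "((\<lambda>r. \<Gamma> r $ 2) has_real_derivative Im (U r)) (at r)"
          using D[of 2] by (simp add: X1_def X2_def axis_def)
        ultimately have "(?f has_real_derivative Re d * Re (U r) + Im d * Im (U r)) (at r)"
          by (intro DERIV_add DERIV_cmult)
        then show ?thesis by simp
      qed
      ultimately obtain \<eta> where \<eta>: "s < \<eta>" "\<eta> < t" "?f t - ?f s = Re (cnj d * U \<eta>) * (t - s)"
        using mvt_field[OF st(1), of ?f "\<lambda>r. Re (cnj d * U r)"] by blast
      \<comment> \<open>The planar displacement between s and t is also the same for both curves,
        which gives an average forward speed of at least 1 / 2.\<close>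
      have "?f t - ?f s = Re (cnj d * (position t - position s))"
        unfolding eqs curve_nth[OF st01(1,4)] curve_nth[OF st01(3,2)] by (simp add: algebra_simps)
      then have "(t - s) / 2 \<le> Re (cnj d * U \<eta>) * (t - s)"
        using fwd \<eta>(3) integral_control[OF st01(1) less_imp_le[OF st(1)] st01(2)] by simp
      then have "1 / 2 * (t - s) \<le> Re (cnj d * U \<eta>) * (t - s)" by linarith
      then have "1 / 2 \<le> Re (cnj d * U \<eta>)" by (rule mult_right_le_imp_le) (use st(1) in simp)
      then show ?thesis using \<eta> by blast
    qed
    then obtain \<eta> where \<eta>: "s < \<eta>" "\<eta> < t" "Re (cnj d * U \<eta>) \<ge> 1 / 2" by blast
    have "1 / 2 < Re (cnj d * (U \<eta> - U \<xi>))" using \<xi>(3) \<eta>(3) by (simp add: algebra_simps)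
    also have "\<dots> \<le> norm (U \<eta> - U \<xi>)"
      using complex_Re_le_cmod[of "cnj d * (U \<eta> - U \<xi>)"] nd by (simp add: norm_mult)
    also have "\<dots> < 1 / 2"
      using \<delta>(2)[of \<xi> \<eta>] \<xi> \<eta> st st01 by (simp add: dist_norm dist_real_def)
    finally show False .
  qed
  then show "{t \<in> {0..1}. \<Gamma> t = curve t} \<in> null_sets lebesgue"
    unfolding K_def[symmetric] using emeasure_eq_measure2[OF Km] fmeasurableD[OF Km]
    by (intro null_setsI) simp_all
qed

end
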